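(* Let $a\in L^\infty(0,1)$ satisfy $\int_0^1a(x)\,dx<0$ and suppose there is $z\in(0,1)$ such that $a(x)>0$ for a.e. $x\in(0,z)$ and $a(x)<0$ for a.e. $x\in(z,1)$. Suppose that $$\text{either}\quad\int_0^z\left(\int_x^za(t)\,dt\right)^{-\frac12}dx=\infty,\quad\text{or}\quad\int_z^1\left(\int_x^za(t)\,dt\right)^{-\frac12}dx=\infty.$$ Let $f\in\mathcal C(\mathbb R)$ satisfy $f(u)\ge0$ for $u\ge0$, and let $\lambda>0$. Then any positive bounded variation solution $u$ of $$-\left(\frac{u'}{\sqrt{1+(u')^2}}\right)'=\lambda a(x)f(u),\quad 0<x<1,\qquad u'(0)=u'(1)=0,$$ is regular.
   Context: A function $u\in BV(0,1)$ is a bounded variation solution of the problem if $$\int_0^1 \frac{Du^a\,D\phi^a}{\sqrt{1+(Du^a)^2}}\,dx+\int_0^1\frac{Du^s}{|Du^s|}\,D\phi^s=\int_0^1\lambda a f(u)\phi\,dx$$ for every $\phi\in BV(0,1)$ such that $|D\phi^s|$ is absolutely continuous with respect to $|Du^s|$. Here, for $v\in BV(0,1)$, $Dv=Dv^a\,dx+Dv^s$ is the Lebesgue decomposition of the measure $Dv$ (with $Dv^a$ the density of the absolutely continuous part and $Dv^s$ the singular part), and $\frac{Dv^s}{|Dv^s|}$ is the density of $Dv^s$ with respect to its total variation $|Dv^s|$. A regular solution is a function $u\in W^{2,1}(0,1)$ satisfying the equation a.e. in $(0,1)$ and the boundary conditions. A solution $u$ is positive if $\operatorname{ess\,inf}u\ge0$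 and $\operatorname{ess\,sup}u>0$. *)

theory Defs
  imports "HOL-Analysis.Analysis" "HOL-Probability.Essential_Supremum"
begin

section \<open>Finite signed measures\<close>

text \<open>
  Signed measures are real-valued set functions on \<^term>\<open>sets M\<close>. Finiteness of the total
  variation is automatic for a countably additive real-valued set function; it is listed
  explicitly only for convenience.
\<close>

definition total_variation :: "'a measure \<Rightarrow> ('a set \<Rightarrow> real) \<Rightarrow> 'a measure" where
  "total_variation M \<mu> = measure_of (space M) (sets M)
     (\<lambda>A. SUP P \<in> {P. finite P \<and> P \<subseteq> sets M \<and> partition_on A P}. \<Sum>B\<in>P. ennreal \<bar>\<mu> B\<bar>)"

definition finite_signed_measure :: "'a measure \<Rightarrow> ('a set \<Rightarrow> real) \<Rightarrow> bool" where
  "finite_signed_measure M \<mu> \<longleftrightarrow>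
     \<mu> {} = 0 \<and>
     (\<forall>A :: nat \<Rightarrow> 'a set. range A \<subseteq> sets M \<longrightarrow> disjoint_family A \<longrightarrow>
        (\<lambda>i. \<mu> (A i)) sums \<mu> (\<Union>i. A i)) \<and>
     emeasure (total_variation M \<mu>) (space M) < \<infinity>"

definition positive_variation :: "'a measure \<Rightarrow> ('a set \<Rightarrow> real) \<Rightarrow> 'a measure" where
  "positive_variation M \<mu> = measure_of (space M) (sets M)
     (\<lambda>A. ennreal ((measure (total_variation M \<mu>) A + \<mu> A) / 2))"

definition negative_variation :: "'a measure \<Rightarrow> ('a set \<Rightarrow> real) \<Rightarrow> 'a measure" where
  "negative_variation M \<mu> = measure_of (space M) (sets M)
     (\<lambda>A. ennreal ((measure (total_variation M \<mu>) A - \<mu> A) / 2))"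

definition signed_integral :: "'a measure \<Rightarrow> ('a set \<Rightarrow> real) \<Rightarrow> ('a \<Rightarrow> real) \<Rightarrow> real" where
  "signed_integral M \<mu> f =
     (LINT x|positive_variation M \<mu>. f x) - (LINT x|negative_variation M \<mu>. f x)"

text \<open>The Radon-Nikodym density \<open>\<mu>/|\<mu>|\<close> of a signed measure with respect to its total variation.\<close>

definition polar_density :: "'a measure \<Rightarrow> ('a set \<Rightarrow> real) \<Rightarrow> 'a \<Rightarrow> real" where
  "polar_density M \<mu> x =
     enn2real (RN_deriv (total_variation M \<mu>) (positive_variation M \<mu>) x) -
     enn2real (RN_deriv (total_variation M \<mu>) (negative_variation M \<mu>) x)"


section \<open>Functions on the unit interval\<close>

text \<open>
  Functions on \<open>(0,1)\<close> are Lebesgue measurable and identified up to null sets, so every notion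
  below is invariant under modification on a null set; signed measures live on the Borel sets.
\<close>

abbreviation leb01 :: "real measure" where
  "leb01 \<equiv> lebesgue_on {0<..<1}"

abbreviation bor01 :: "real measure" where
  "bor01 \<equiv> restrict_space borel {0<..<1}"

definition essinf :: "'a measure \<Rightarrow> ('a \<Rightarrow> ereal) \<Rightarrow> ereal" where
  "essinf M f = - esssup M (\<lambda>x. - f x)"

definition Linfty01 :: "(real \<Rightarrow> real) \<Rightarrow> bool" where
  "Linfty01 a \<longleftrightarrow> a \<in> borel_measurable leb01 \<and> esssup leb01 (\<lambda>x. ereal \<bar>a x\<bar>) < \<infinity>"

text \<open>Test functions: the class \<open>C\<^sub>c\<^sup>1(0,1)\<close>.\<close>

definition test_function :: "(real \<Rightarrow> real) \<Rightarrow> bool" where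
  "test_function \<phi> \<longleftrightarrow> \<phi> C1_differentiable_on UNIV \<and>
     (\<exists>K. compact K \<and> K \<subseteq> {0<..<1} \<and> (\<forall>x. x \<notin> K \<longrightarrow> \<phi> x = 0))"

definition weak_deriv :: "(real \<Rightarrow> real) \<Rightarrow> (real \<Rightarrow> real) \<Rightarrow> bool" where
  "weak_deriv u v \<longleftrightarrow> integrable leb01 u \<and> integrable leb01 v \<and>
     (\<forall>\<phi>. test_function \<phi> \<longrightarrow>
        (LINT x|leb01. u x * deriv \<phi> x) = - (LINT x|leb01. v x * \<phi> x))"

text \<open>\<open>BV_deriv u \<mu>\<close>: \<open>u \<in> BV(0,1)\<close> and its distributional derivative \<open>Du\<close> is \<open>\<mu>\<close>.\<close>

definition BV_deriv :: "(real \<Rightarrow> real) \<Rightarrow> (real set \<Rightarrow> real) \<Rightarrow> bool" where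
  "BV_deriv u \<mu> \<longleftrightarrow> integrable leb01 u \<and> finite_signed_measure bor01 \<mu> \<and>
     (\<forall>\<phi>. test_function \<phi> \<longrightarrow>
        (LINT x|leb01. u x * deriv \<phi> x) = - signed_integral bor01 \<mu> \<phi>)"

text \<open>\<open>lebesgue_decomp \<mu> g \<sigma>\<close>: \<open>\<mu> = g dx + \<sigma>\<close> with \<open>\<sigma>\<close> singular to Lebesgue measure.\<close>

definition lebesgue_decomp ::
    "(real set \<Rightarrow> real) \<Rightarrow> (real \<Rightarrow> real) \<Rightarrow> (real set \<Rightarrow> real) \<Rightarrow> bool" where
  "lebesgue_decomp \<mu> g \<sigma> \<longleftrightarrow> integrable leb01 g \<and> finite_signed_measure bor01 \<sigma> \<and>
     (\<exists>N \<in> sets bor01. emeasure lborel N = 0 \<and>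
        emeasure (total_variation bor01 \<sigma>) (space bor01 - N) = 0) \<and>
     (\<forall>A \<in> sets bor01. \<mu> A = (LINT x:A|leb01. g x) + \<sigma> A)"


section \<open>Solutions\<close>

text \<open>
  In both definitions the derivatives and their decompositions are unique (up to null sets),
  so quantifying over them amounts to naming them.
\<close>

definition bv_solution :: "(real \<Rightarrow> real) \<Rightarrow> (real \<Rightarrow> real) \<Rightarrow> real \<Rightarrow> (real \<Rightarrow> real) \<Rightarrow> bool" where
  "bv_solution a f lam u \<longleftrightarrow>
     (\<exists>Du Dua Dus. BV_deriv u Du \<and> lebesgue_decomp Du Dua Dus \<and>
       (\<forall>\<phi> D\<phi> D\<phi>a D\<phi>s.
          BV_deriv \<phi> D\<phi> \<longrightarrow> lebesgue_decomp D\<phi> D\<phi>a D\<phi>s \<longrightarrow>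
          absolutely_continuous (total_variation bor01 Dus) (total_variation bor01 D\<phi>s) \<longrightarrow>
          (LINT x|leb01. Dua x * D\<phi>a x / sqrt (1 + (Dua x)\<^sup>2))
            + signed_integral bor01 D\<phi>s (polar_density bor01 Dus)
          = (LINT x|leb01. lam * a x * f (u x) * \<phi> x)))"

text \<open>
  Here \<open>v\<close> is the continuous representative on \<open>[0,1]\<close> of \<open>u'\<close>, which gives meaning to the boundary
  conditions, \<open>w = u''\<close>, and \<open>q\<close> is the derivative of \<open>u'/sqrt(1+(u')\<^sup>2)\<close>.
\<close>

definition regular_solution :: "(real \<Rightarrow> real) \<Rightarrow> (real \<Rightarrow> real) \<Rightarrow> real \<Rightarrow> (real \<Rightarrow> real) \<Rightarrow> bool" where
  "regular_solution a f lam u \<longleftrightarrow>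
     (\<exists>v w q. weak_deriv u v \<and> weak_deriv v w \<and>
        continuous_on {0..1} v \<and> v 0 = 0 \<and> v 1 = 0 \<and>
        weak_deriv (\<lambda>x. v x / sqrt (1 + (v x)\<^sup>2)) q \<and>
        (AE x in leb01. - q x = lam * a x * f (u x)))"

definition positive_function :: "(real \<Rightarrow> real) \<Rightarrow> bool" where
  "positive_function u \<longleftrightarrow>
     essinf leb01 (\<lambda>x. ereal (u x)) \<ge> 0 \<and> esssup leb01 (\<lambda>x. ereal (u x)) > 0"

end

theory Submission
  imports Defs "HOL-Probability.Distribution_Functions"
begin

text \<open>
  Write \<open>Du = g dx + \<sigma>\<close> with \<open>\<sigma>\<close> singular, and \<open>k = \<lambda> a f(u)\<close>. Since functions of bounded variation are
  bounded (\<open>BV_bounded\<close>), \<open>k\<close> is bounded, and \<open>F y = \<integral>\<^sub>y\<^sup>1 k\<close>, written \<open>tail k\<close> below, is Lipschitz.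

  The proof tests the equation with the constant 1 and with distribution functions
  \<open>\<phi> x = \<rho>((0,x])\<close> of finite positive measures \<open>\<rho>\<close>. These have derivative \<open>\<rho>\<close>, and Fubini turns the
  right-hand side into \<open>\<integral> F d\<rho>\<close>. The constant gives \<open>F 0 = 0\<close>; Lebesgue measure on a Borel set gives
  \<open>g / sqrt (1 + g\<^sup>2) = F\<close> almost everywhere (\<open>weak_equation_density\<close>); and \<open>|\<sigma>|\<close> on a Borel set \<open>A\<close>
  gives \<open>\<sigma> A = \<integral>\<^sub>A F d|\<sigma>|\<close> (\<open>weak_equation_singular\<close>). So \<open>F\<close> is the flux, and it is also the polar
  density of \<open>\<sigma>\<close>.

  Because \<open>f(u) \<ge> 0\<close>, the signs of \<open>k\<close> and \<open>a\<close> are never opposite. Hence \<open>F\<close> decreases from 0 to a minimum at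
  \<open>z\<close> and increases back to 0. Suppose \<open>F z \<le> -1\<close>. Since \<open>|k| \<le> c |a|\<close> for a constant \<open>c\<close>,
  the distance \<open>1 + F x\<close> is at most \<open>c A x\<close> with \<open>A x = \<integral>\<^sub>x\<^sup>z a\<close>, on both sides of \<open>z\<close>. But
  \<open>1 + g\<^sup>2 = 1 / (1 - F\<^sup>2)\<close>, so \<open>1 + |g|\<close> is at least of the order of \<open>A\<close> to the power \<open>-1/2\<close>
  (\<open>powr_le_slope\<close>). As \<open>g\<close> is integrable, both integrals in the hypothesis would be finite, a
  contradiction.

  Therefore \<open>|F| \<le> \<theta>\<close> for some \<open>\<theta> < 1\<close>. A signed measure whose polar density is bounded by \<open>\<theta> < 1\<close>
  vanishes (\<open>finite_signed_measure_eq_0\<close>), so \<open>\<sigma> = 0\<close> and \<open>u' = F / sqrt (1 - F\<^sup>2)\<close>. This is a smooth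
  function of a Lipschitz function, and by the chain rule \<open>tail_chain_rule\<close> it has a bounded weak
  derivative; it vanishes at 0 and 1 together with \<open>F\<close>.
\<close>

section \<open>Total variation and Jordan decomposition of signed measures\<close>

text \<open>
  The set function from which \<^const>\<open>total_variation\<close> is built. It gets a name of its own because
  \<^const>\<open>measure_of\<close> returns the zero measure unless its argument is countably additive, which for
  this supremum has to be shown first.
\<close>

definition variation :: "'a measure \<Rightarrow> ('a set \<Rightarrow> real) \<Rightarrow> 'a set \<Rightarrow> ennreal" where
  "variation M \<mu> A =
     (SUP P \<in> {P. finite P \<and> P \<subseteq> sets M \<and> partition_on A P}. \<Sum>B\<in>P. ennreal \<bar>\<mu> B\<bar>)"

lemma total_variation_variation:
  "total_variation M \<mu> = measure_of (space M) (sets M) (variation M \<mu>)"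
  unfolding total_variation_def variation_def ..

lemma variation_upper:
  "finite P \<Longrightarrow> P \<subseteq> sets M \<Longrightarrow> partition_on A P \<Longrightarrow> (\<Sum>B\<in>P. ennreal \<bar>\<mu> B\<bar>) \<le> variation M \<mu> A"
  unfolding variation_def by (rule SUP_upper) auto

lemma variation_least:
  "(\<And>P. finite P \<Longrightarrow> P \<subseteq> sets M \<Longrightarrow> partition_on A P \<Longrightarrow> (\<Sum>B\<in>P. ennreal \<bar>\<mu> B\<bar>) \<le> c)
    \<Longrightarrow> variation M \<mu> A \<le> c"
  unfolding variation_def by (rule SUP_least) auto

lemma variation_ge:
  assumes "A \<in> sets M" "\<mu> {} = 0" shows "ennreal \<bar>\<mu> A\<bar> \<le> variation M \<mu> A"
proof (cases "A = {}")
  case True then show ?thesis using assms by simp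
next
  case False
  have "partition_on A {A}" using False by (rule partition_on_space)
  from variation_upper[OF _ _ this, of M \<mu>] show ?thesis using assms by simp
qed

lemma variation_empty: "variation M \<mu> {} = 0"
proof -
  have "variation M \<mu> {} \<le> 0" by (rule variation_least) (auto simp: partition_on_empty)
  then show ?thesis by simp
qed

text \<open>
  A partition of \<open>A\<close> and a partition of \<open>B\<close> together partition \<open>A \<union> B\<close>. Measurability guarantees that
  each of the two suprema ranges over a nonempty set, so that addition may be moved inside.
\<close>

lemma variation_superadditive:
  assumes A: "A \<in> sets M" and B: "B \<in> sets M" and disj: "A \<inter> B = {}"
  shows "variation M \<mu> A + variation M \<mu> B \<le> variation M \<mu> (A \<union> B)"
proof -
  let ?Q = "\<lambda>A. {P. finite P \<and> P \<subseteq> sets M \<and> partition_on A P}"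
  have ne: "?Q C \<noteq> {}" if "C \<in> sets M" for C
  proof (cases "C = {}")
    case True
    then have "{} \<in> ?Q C" by (simp add: partition_on_empty)
    then show ?thesis by blast
  next
    case False
    then have "{C} \<in> ?Q C" using that by (simp add: partition_on_space)
    then show ?thesis by blast
  qed
  have key: "(\<Sum>C\<in>P. ennreal \<bar>\<mu> C\<bar>) + (\<Sum>C\<in>R. ennreal \<bar>\<mu> C\<bar>) \<le> variation M \<mu> (A \<union> B)"
    if P: "P \<in> ?Q A" and R: "R \<in> ?Q B" for P R
  proof -
    have "partition_on (A \<union> B) (P \<union> R)"
    proof (rule partition_onI)
      fix p q assume "p \<in> P \<union> R" "q \<in> P \<union> R" "p \<noteq> q"
      moreover have "disjoint (P \<union> R)"
        using P R disj by (intro disjoint_union) (simp_all add: partition_on_def)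
      ultimately show "disjnt p q" by (simp add: pairwiseD)
    qed (use P R in \<open>auto simp: partition_on_def\<close>)
    moreover have "P \<inter> R = {}"
    proof (rule ccontr)
      assume "P \<inter> R \<noteq> {}"
      then obtain C where C: "C \<in> P" "C \<in> R" by blast
      then have "C \<subseteq> A" "C \<subseteq> B" "C \<noteq> {}"
        using P R by (auto simp: partition_on_def)
      then show False using disj by blast
    qed
    ultimately show ?thesis
      using variation_upper[of "P \<union> R" M "A \<union> B" \<mu>] P R by (simp add: sum.union_disjoint)
  qed
  have "variation M \<mu> A + variation M \<mu> B =
      (SUP P\<in>?Q A. (\<Sum>C\<in>P. ennreal \<bar>\<mu> C\<bar>) + variation M \<mu> B)"
    using ne[OF A] by (subst ennreal_SUP_add_left) (auto simp: variation_def)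
  also have "\<dots> \<le> variation M \<mu> (A \<union> B)"
  proof (rule SUP_least)
    fix P assume P: "P \<in> ?Q A"
    have "(\<Sum>C\<in>P. ennreal \<bar>\<mu> C\<bar>) + variation M \<mu> B =
          (SUP R\<in>?Q B. (\<Sum>C\<in>P. ennreal \<bar>\<mu> C\<bar>) + (\<Sum>C\<in>R. ennreal \<bar>\<mu> C\<bar>))"
      using ne[OF B] by (subst ennreal_SUP_add_right[symmetric]) (auto simp: variation_def)
    also have "\<dots> \<le> variation M \<mu> (A \<union> B)" by (rule SUP_least) (rule key[OF P])
    finally show "(\<Sum>C\<in>P. ennreal \<bar>\<mu> C\<bar>) + variation M \<mu> B \<le> variation M \<mu> (A \<union> B)" .
  qed
  finally show ?thesis .
qed

lemma variation_mono:
  assumes "A \<in> sets M" "B \<in> sets M" "A \<subseteq> B"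
  shows "variation M \<mu> A \<le> variation M \<mu> B"
proof -
  have "variation M \<mu> A + variation M \<mu> (B - A) \<le> variation M \<mu> (A \<union> (B - A))"
    by (rule variation_superadditive) (use assms in auto)
  then have "variation M \<mu> A + variation M \<mu> (B - A) \<le> variation M \<mu> B"
    using assms(3) by (simp add: Un_absorb1)
  then show ?thesis by (metis add.right_neutral add_left_mono order_trans zero_le)
qed

lemma ennreal_abs_sums_le:
  fixes x :: "nat \<Rightarrow> real"
  assumes "x sums s" shows "ennreal \<bar>s\<bar> \<le> (\<Sum>i. ennreal \<bar>x i\<bar>)"
proof (rule LIMSEQ_le_const2)
  show "(\<lambda>n. ennreal \<bar>\<Sum>i<n. x i\<bar>) \<longlonglongrightarrow> ennreal \<bar>s\<bar>"
    using assms unfolding sums_def by (intro tendsto_ennrealI tendsto_rabs)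
  have "ennreal \<bar>\<Sum>i<n. x i\<bar> \<le> (\<Sum>i. ennreal \<bar>x i\<bar>)" for n
  proof -
    have "ennreal \<bar>\<Sum>i<n. x i\<bar> \<le> ennreal (\<Sum>i<n. \<bar>x i\<bar>)" by (intro ennreal_leI sum_abs)
    also have "\<dots> = (\<Sum>i<n. ennreal \<bar>x i\<bar>)" by simp
    also have "\<dots> \<le> (\<Sum>i. ennreal \<bar>x i\<bar>)" by (rule sum_le_suminf) auto
    finally show ?thesis .
  qed
  then show "\<exists>N. \<forall>n\<ge>N. ennreal \<bar>\<Sum>i<n. x i\<bar> \<le> (\<Sum>i. ennreal \<bar>x i\<bar>)" by blast
qed

text \<open>
  The parts of \<open>P\<close> that meet \<open>C\<close> have pairwise distinct traces there, and these traces partition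
  \<open>C\<close>; the other parts contribute \<open>\<mu> {} = 0\<close>.
\<close>

lemma variation_trace:
  assumes P: "finite P" "P \<subseteq> sets M" "partition_on A P" and C: "C \<in> sets M" "C \<subseteq> A"
    and "\<mu> {} = 0"
  shows "(\<Sum>B\<in>P. ennreal \<bar>\<mu> (B \<inter> C)\<bar>) \<le> variation M \<mu> C"
proof -
  let ?P = "{B \<in> P. B \<inter> C \<noteq> {}}"
  have "(\<Sum>B\<in>P. ennreal \<bar>\<mu> (B \<inter> C)\<bar>) = (\<Sum>B\<in>?P. ennreal \<bar>\<mu> (B \<inter> C)\<bar>)"
    using assms by (intro sum.mono_neutral_right) auto
  also have "\<dots> = (\<Sum>D\<in>(\<lambda>B. B \<inter> C) ` ?P. ennreal \<bar>\<mu> D\<bar>)"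
  proof (rule sum.reindex[symmetric, unfolded o_def])
    show "inj_on (\<lambda>B. B \<inter> C) ?P"
      using partition_onD2[OF P(3)] unfolding inj_on_def disjoint_def by blast
  qed
  also have "\<dots> \<le> variation M \<mu> C"
  proof (rule variation_upper)
    show "partition_on C ((\<lambda>B. B \<inter> C) ` ?P)"
    proof (rule partition_onI)
      show "\<Union> ((\<lambda>B. B \<inter> C) ` ?P) = C"
        using partition_onD1[OF P(3)] C(2) by auto
      fix D E assume "D \<in> (\<lambda>B. B \<inter> C) ` ?P" "E \<in> (\<lambda>B. B \<inter> C) ` ?P" "D \<noteq> E"
      then show "disjnt D E"
        using disjointD[OF partition_onD2[OF P(3)]] by (auto simp: disjnt_def)
    qed auto
  qed (use P C in auto)
  finally show ?thesis .
qed

lemma finite_signed_measureD: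
  assumes "finite_signed_measure M \<mu>"
  shows "\<mu> {} = 0"
    and "\<And>A :: nat \<Rightarrow> 'a set. range A \<subseteq> sets M \<Longrightarrow> disjoint_family A \<Longrightarrow> (\<lambda>i. \<mu> (A i)) sums \<mu> (\<Union>i. A i)"
  using assms unfolding finite_signed_measure_def by auto

text \<open>
  Superadditivity bounds the finite partial sums from above. Conversely, cutting every part of a
  partition of the union along the sets \<open>A i\<close> only increases its sum, by countable additivity of
  \<open>\<mu>\<close>, and sorts it into sums over partitions of the single \<open>A i\<close>.
\<close>

lemma countably_additive_variation:
  fixes \<mu> :: "'a set \<Rightarrow> real"
  assumes "finite_signed_measure M \<mu>"
  shows "countably_additive (sets M) (variation M \<mu>)"
proof (rule countably_additiveI)
  fix A :: "nat \<Rightarrow> 'a set"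
  assume A: "range A \<subseteq> sets M" "disjoint_family A" "(\<Union>i. A i) \<in> sets M"
  note \<mu> = finite_signed_measureD[OF assms]
  have Ai: "A i \<in> sets M" for i using A(1) by blast
  have UA: "(\<Union>i<n. A i) \<in> sets M" for n :: nat
    by (rule sets.finite_UN) (simp_all add: Ai)
  show "(\<Sum>i. variation M \<mu> (A i)) = variation M \<mu> (\<Union>i. A i)"
  proof (rule antisym)
    show "(\<Sum>i. variation M \<mu> (A i)) \<le> variation M \<mu> (\<Union>i. A i)"
    proof (rule suminf_le_const)
      fix n
      have "(\<Sum>i<n. variation M \<mu> (A i)) \<le> variation M \<mu> (\<Union>i<n. A i)"
      proof (induction n)
        case (Suc n)
        have "A i \<inter> A n = {}" if "i < n" for i
          using disjoint_family_onD[OF A(2), of i n] that by simp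
        then have "(\<Union>i<n. A i) \<inter> A n = {}" by blast
        then have "variation M \<mu> (\<Union>i<n. A i) + variation M \<mu> (A n) \<le> variation M \<mu> ((\<Union>i<n. A i) \<union> A n)"
          by (rule variation_superadditive[OF UA Ai])
        moreover have "(\<Union>i<n. A i) \<union> A n = (\<Union>i<Suc n. A i)"
          by (auto simp: less_Suc_eq)
        ultimately have "variation M \<mu> (\<Union>i<n. A i) + variation M \<mu> (A n) \<le> variation M \<mu> (\<Union>i<Suc n. A i)"
          by simp
        with add_right_mono[OF Suc] show ?case
          unfolding sum.lessThan_Suc by (rule order_trans)
      qed (simp add: variation_empty)
      also have "\<dots> \<le> variation M \<mu> (\<Union>i. A i)"
        by (rule variation_mono[OF UA A(3)]) auto
      finally show "(\<Sum>i<n. variation M \<mu> (A i)) \<le> variation M \<mu> (\<Union>i. A i)" .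
    qed simp
    show "variation M \<mu> (\<Union>i. A i) \<le> (\<Sum>i. variation M \<mu> (A i))"
    proof (rule variation_least)
      fix P assume P: "finite P" "P \<subseteq> sets M" "partition_on (\<Union>i. A i) P"
      have "(\<Sum>B\<in>P. ennreal \<bar>\<mu> B\<bar>) \<le> (\<Sum>B\<in>P. \<Sum>i. ennreal \<bar>\<mu> (B \<inter> A i)\<bar>)"
      proof (intro sum_mono ennreal_abs_sums_le)
        fix B assume B: "B \<in> P"
        have "(\<lambda>i. \<mu> (B \<inter> A i)) sums \<mu> (\<Union>i. B \<inter> A i)"
        proof (rule \<mu>(2))
          show "range (\<lambda>i. B \<inter> A i) \<subseteq> sets M" using Ai B P(2) by auto
          show "disjoint_family (\<lambda>i. B \<inter> A i)" using A(2) by (auto simp: disjoint_family_on_def)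
        qed
        moreover have "(\<Union>i. B \<inter> A i) = B"
          using B P(3) by (auto simp: partition_on_def)
        ultimately show "(\<lambda>i. \<mu> (B \<inter> A i)) sums \<mu> B" by simp
      qed
      also have "\<dots> = (\<Sum>i. \<Sum>B\<in>P. ennreal \<bar>\<mu> (B \<inter> A i)\<bar>)"
        by (rule suminf_sum[symmetric]) simp
      also have "\<dots> \<le> (\<Sum>i. variation M \<mu> (A i))"
      proof (rule suminf_le)
        show "(\<Sum>B\<in>P. ennreal \<bar>\<mu> (B \<inter> A i)\<bar>) \<le> variation M \<mu> (A i)" for i
          by (rule variation_trace[where A = "\<Union>i. A i"]) (use P Ai \<mu>(1) in auto)
      qed simp_all
      finally show "(\<Sum>B\<in>P. ennreal \<bar>\<mu> B\<bar>) \<le> (\<Sum>i. variation M \<mu> (A i))" .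
    qed
  qed
qed

lemma space_total_variation [simp]: "space (total_variation M \<mu>) = space M"
  and sets_total_variation [simp, measurable_cong]: "sets (total_variation M \<mu>) = sets M"
  and space_positive_variation [simp]: "space (positive_variation M \<mu>) = space M"
  and sets_positive_variation [simp, measurable_cong]: "sets (positive_variation M \<mu>) = sets M"
  and space_negative_variation [simp]: "space (negative_variation M \<mu>) = space M"
  and sets_negative_variation [simp, measurable_cong]: "sets (negative_variation M \<mu>) = sets M"
  unfolding total_variation_def positive_variation_def negative_variation_def by simp_all

lemma emeasure_total_variation:
  assumes "finite_signed_measure M \<mu>" "A \<in> sets M"
  shows "emeasure (total_variation M \<mu>) A = variation M \<mu> A"
  using emeasure_measure_of_sigma[OF sets.sigma_algebra_axioms, of M "variation M \<mu>" A]
    countably_additive_variation[OF assms(1)] assms(2)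
  by (simp add: total_variation_variation positive_def variation_empty)

lemma finite_measure_total_variation:
  assumes "finite_signed_measure M \<mu>" shows "finite_measure (total_variation M \<mu>)"
  using assms by (intro finite_measureI) (auto simp: finite_signed_measure_def)

lemma abs_le_total_variation:
  assumes "finite_signed_measure M \<mu>" "A \<in> sets M"
  shows "\<bar>\<mu> A\<bar> \<le> measure (total_variation M \<mu>) A"
proof -
  interpret finite_measure "total_variation M \<mu>" by (rule finite_measure_total_variation[OF assms(1)])
  have "ennreal \<bar>\<mu> A\<bar> \<le> emeasure (total_variation M \<mu>) A"
    using variation_ge[of A M \<mu>] finite_signed_measureD(1)[OF assms(1)] assms(2)
    by (simp add: emeasure_total_variation assms)
  then show ?thesis by (simp add: emeasure_eq_measure)
qed

text \<open>
  The factor \<open>s = 1\<close> yields the positive variation and \<open>s = -1\<close> the negative one.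
\<close>

lemma emeasure_half_variation:
  assumes \<mu>: "finite_signed_measure M \<mu>" "A \<in> sets M" and s: "\<bar>s\<bar> \<le> (1::real)"
  shows "emeasure (measure_of (space M) (sets M)
     (\<lambda>A. ennreal ((measure (total_variation M \<mu>) A + s * \<mu> A) / 2))) A =
     ennreal ((measure (total_variation M \<mu>) A + s * \<mu> A) / 2)"
proof (rule emeasure_measure_of_sigma[OF sets.sigma_algebra_axioms _ _ assms(2)])
  interpret T: finite_measure "total_variation M \<mu>" by (rule finite_measure_total_variation[OF \<mu>(1)])
  let ?h = "\<lambda>A. (measure (total_variation M \<mu>) A + s * \<mu> A) / 2"
  show "positive (sets M) (\<lambda>A. ennreal (?h A))"
    using finite_signed_measureD(1)[OF \<mu>(1)] by (simp add: positive_def)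
  have nonneg: "0 \<le> ?h B" if "B \<in> sets M" for B
  proof -
    have "\<bar>s * \<mu> B\<bar> \<le> 1 * measure (total_variation M \<mu>) B"
      unfolding abs_mult by (intro mult_mono s abs_le_total_variation[OF \<mu>(1) that]) auto
    then have "- (s * \<mu> B) \<le> measure (total_variation M \<mu>) B"
      using abs_le_D2[of "s * \<mu> B"] by simp
    then show ?thesis by simp
  qed
  show "countably_additive (sets M) (\<lambda>A. ennreal (?h A))"
  proof (rule countably_additiveI)
    fix A :: "nat \<Rightarrow> 'a set"
    assume A: "range A \<subseteq> sets M" "disjoint_family A" "(\<Union>i. A i) \<in> sets M"
    have "(\<lambda>i. ?h (A i)) sums ?h (\<Union>i. A i)"
      using A by (intro sums_divide sums_add sums_mult T.finite_measure_UNION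
          finite_signed_measureD(2)[OF \<mu>(1)]) auto
    with A nonneg show "(\<Sum>i. ennreal (?h (A i))) = ennreal (?h (\<Union>i. A i))"
      by (intro suminf_ennreal_eq) auto
  qed
qed

lemma emeasure_positive_variation:
  assumes "finite_signed_measure M \<mu>" "A \<in> sets M"
  shows "emeasure (positive_variation M \<mu>) A = ennreal ((measure (total_variation M \<mu>) A + \<mu> A) / 2)"
  using emeasure_half_variation[OF assms, of 1] by (simp add: positive_variation_def)

lemma emeasure_negative_variation:
  assumes "finite_signed_measure M \<mu>" "A \<in> sets M"
  shows "emeasure (negative_variation M \<mu>) A = ennreal ((measure (total_variation M \<mu>) A - \<mu> A) / 2)"
  using emeasure_half_variation[OF assms, of "- 1"] by (simp add: negative_variation_def)

lemma finite_measure_positive_variation: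
  "finite_signed_measure M \<mu> \<Longrightarrow> finite_measure (positive_variation M \<mu>)"
  by (intro finite_measureI) (simp add: emeasure_positive_variation)

lemma finite_measure_negative_variation:
  "finite_signed_measure M \<mu> \<Longrightarrow> finite_measure (negative_variation M \<mu>)"
  by (intro finite_measureI) (simp add: emeasure_negative_variation)

lemma measure_positive_variation:
  assumes "finite_signed_measure M \<mu>" "A \<in> sets M"
  shows "measure (positive_variation M \<mu>) A = (measure (total_variation M \<mu>) A + \<mu> A) / 2"
  using emeasure_positive_variation[OF assms] abs_le_total_variation[OF assms]
  by (simp add: measure_def[of "positive_variation M \<mu>"])

lemma measure_negative_variation:
  assumes "finite_signed_measure M \<mu>" "A \<in> sets M"
  shows "measure (negative_variation M \<mu>) A = (measure (total_variation M \<mu>) A - \<mu> A) / 2"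
  using emeasure_negative_variation[OF assms] abs_le_total_variation[OF assms]
  by (simp add: measure_def[of "negative_variation M \<mu>"])

lemma jordan_decomposition:
  assumes "finite_signed_measure M \<mu>" "A \<in> sets M"
  shows "\<mu> A = measure (positive_variation M \<mu>) A - measure (negative_variation M \<mu>) A"
  by (simp add: measure_positive_variation measure_negative_variation assms field_simps)

text \<open>
  If the signed measure is an ordinary finite measure, then it is its own total and positive
  variation, and integrals against it are ordinary integrals, whatever the integrand. The weak
  equation is tested below only with functions whose derivative is such a measure.
\<close>

context
  fixes M \<rho> :: "'a measure"
  assumes fin: "finite_measure \<rho>" and sets: "sets \<rho> = sets M"
begin

interpretation finite_measure \<rho> by (rule fin)

lemma variation_measure:
  assumes "A \<in> sets M" shows "variation M (measure \<rho>) A = emeasure \<rho> A"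
proof (rule antisym)
  show "variation M (measure \<rho>) A \<le> emeasure \<rho> A"
  proof (rule variation_least)
    fix P assume P: "finite P" "P \<subseteq> sets M" "partition_on A P"
    have "(\<Sum>B\<in>P. ennreal \<bar>measure \<rho> B\<bar>) = (\<Sum>B\<in>P. emeasure \<rho> B)"
      by (simp add: emeasure_eq_measure)
    also have "\<dots> = emeasure \<rho> (\<Union>B\<in>P. B)"
      using P sets by (intro sum_emeasure) (auto simp: partition_on_def disjoint_family_on_def disjoint_def)
    finally show "(\<Sum>B\<in>P. ennreal \<bar>measure \<rho> B\<bar>) \<le> emeasure \<rho> A"
      using P(3) by (simp add: partition_on_def)
  qed
  show "emeasure \<rho> A \<le> variation M (measure \<rho>) A"
    using variation_ge[OF assms, of "measure \<rho>"] by (simp add: emeasure_eq_measure)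
qed

lemma total_variation_measure: "total_variation M (measure \<rho>) = \<rho>"
proof -
  have "total_variation M (measure \<rho>) = measure_of (space M) (sets M) (emeasure \<rho>)"
    unfolding total_variation_variation using variation_measure
    by (intro measure_of_eq) (auto simp: sets.space_closed sets.sigma_sets_eq)
  also have "\<dots> = \<rho>" using measure_of_of_measure[of \<rho>] sets sets_eq_imp_space_eq[OF sets] by simp
  finally show ?thesis .
qed

lemma finite_signed_measure_measure: "finite_signed_measure M (measure \<rho>)"
  unfolding finite_signed_measure_def total_variation_measure
  using finite_measure_UNION sets by (auto simp: emeasure_eq_measure)

lemma positive_variation_measure: "positive_variation M (measure \<rho>) = \<rho>"
  by (rule measure_eqI)
    (simp_all add: emeasure_positive_variation[OF finite_signed_measure_measure]
      total_variation_measure sets emeasure_eq_measure)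

lemma negative_variation_measure: "negative_variation M (measure \<rho>) = null_measure M"
  by (rule measure_eqI)
    (simp_all add: emeasure_negative_variation[OF finite_signed_measure_measure]
      total_variation_measure)

lemma signed_integral_measure: "signed_integral M (measure \<rho>) f = (LINT x|\<rho>. f x)"
proof -
  have "(LINT x|null_measure M. f x) = 0"
    by (rule integral_eq_zero_AE) (auto intro!: AE_I[of _ _ "space M"])
  then show ?thesis
    by (simp add: signed_integral_def positive_variation_measure negative_variation_measure)
qed

end

lemma total_variation_cong:
  "(\<And>A. A \<in> sets M \<Longrightarrow> \<bar>\<mu> A\<bar> = \<bar>\<nu> A\<bar>) \<Longrightarrow> total_variation M \<mu> = total_variation M \<nu>"
proof -
  assume *: "\<And>A. A \<in> sets M \<Longrightarrow> \<bar>\<mu> A\<bar> = \<bar>\<nu> A\<bar>"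
  have "variation M \<mu> = variation M \<nu>"
    unfolding variation_def fun_eq_iff
    by (intro allI SUP_cong refl sum.cong arg_cong[of _ _ ennreal] *) (auto dest: subsetD)
  then show ?thesis by (simp add: total_variation_variation)
qed

text \<open>
  A solution turns out to be nonincreasing, so its derivative is the negative of a measure.
\<close>

lemma signed_integral_uminus_measure:
  assumes "finite_measure \<rho>" "sets \<rho> = sets M" and \<mu>: "\<And>A. A \<in> sets M \<Longrightarrow> \<mu> A = - measure \<rho> A"
  shows "signed_integral M \<mu> f = - (LINT x|\<rho>. f x)"
proof -
  have tv: "total_variation M \<mu> = total_variation M (measure \<rho>)"
    by (rule total_variation_cong) (simp add: \<mu>)
  have "positive_variation M \<mu> = negative_variation M (measure \<rho>)"
    "negative_variation M \<mu> = positive_variation M (measure \<rho>)"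
    unfolding positive_variation_def negative_variation_def tv
    by (intro measure_of_eq; simp add: sets.space_closed sets.sigma_sets_eq \<mu>)+
  then have "signed_integral M \<mu> f = - signed_integral M (measure \<rho>) f"
    by (simp add: signed_integral_def)
  then show ?thesis by (simp add: signed_integral_measure[OF assms(1,2)])
qed

section \<open>Polar densities and distribution functions\<close>

lemma finite_measure_leb01: "finite_measure leb01"
  by (rule finite_measure_lebesgue_on) simp

text \<open>
  Domination gives absolute continuity, so the Radon-Nikodym theorem applies.
\<close>

lemma RN_deriv_dominated:
  assumes "finite_measure T" "finite_measure N" "sets N = sets T"
    and le: "\<And>A. A \<in> sets T \<Longrightarrow> emeasure N A \<le> emeasure T A" and A: "A \<in> sets T"
  shows "integrable T (\<lambda>x. enn2real (RN_deriv T N x))"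
    and "(LINT x|T. enn2real (RN_deriv T N x) * indicator A x) = measure N A"
proof -
  interpret T: finite_measure T by fact
  interpret N: finite_measure N by fact
  have ac: "absolutely_continuous T N"
    unfolding absolutely_continuous_def
  proof
    fix B assume "B \<in> null_sets T"
    then show "B \<in> null_sets N" using le[of B] by (simp add: null_sets_def assms(3))
  qed
  note RN = T.RN_deriv_integrable[OF N.sigma_finite_measure_axioms ac assms(3)]
    T.RN_deriv_integral[OF N.sigma_finite_measure_axioms ac assms(3)]
  have *: "A \<in> sets N" "space N = space T" using A assms(3) sets_eq_imp_space_eq by auto
  show "integrable T (\<lambda>x. enn2real (RN_deriv T N x))"
    using RN(1)[of "\<lambda>_. 1"] by simp
  have "(\<lambda>x. indicator A x :: real) \<in> borel_measurable T" using A by simp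
  from RN(2)[OF this] show "(LINT x|T. enn2real (RN_deriv T N x) * indicator A x) = measure N A"
    using A sets.sets_into_space[OF A] by (simp add: * Int_absorb2)
qed

text \<open>
  The positive and the negative variation are both dominated by the total variation; the difference
  of their densities represents \<open>\<mu>\<close> by the Jordan decomposition.
\<close>

lemma polar_density_integral:
  assumes \<mu>: "finite_signed_measure M \<mu>" and A: "A \<in> sets M"
  shows "integrable (total_variation M \<mu>) (polar_density M \<mu>)"
    and "(LINT x|total_variation M \<mu>. polar_density M \<mu> x * indicator A x) = \<mu> A"
proof -
  let ?T = "total_variation M \<mu>"
  interpret T: finite_measure ?T by (rule finite_measure_total_variation[OF \<mu>])
  have le: "emeasure (positive_variation M \<mu>) B \<le> emeasure ?T B"
    "emeasure (negative_variation M \<mu>) B \<le> emeasure ?T B" if "B \<in> sets ?T" for B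
  proof -
    have B: "B \<in> sets M" using that by simp
    show "emeasure (positive_variation M \<mu>) B \<le> emeasure ?T B"
      "emeasure (negative_variation M \<mu>) B \<le> emeasure ?T B"
      using abs_le_total_variation[OF \<mu> B]
      unfolding T.emeasure_eq_measure emeasure_positive_variation[OF \<mu> B]
        emeasure_negative_variation[OF \<mu> B] by (auto intro!: ennreal_leI)
  qed
  have A': "A \<in> sets ?T" using A by simp
  note p = RN_deriv_dominated[OF T.finite_measure_axioms finite_measure_positive_variation[OF \<mu>] _ le(1) A']
  note n = RN_deriv_dominated[OF T.finite_measure_axioms finite_measure_negative_variation[OF \<mu>] _ le(2) A']
  show "integrable ?T (polar_density M \<mu>)"
    using p(1) n(1) unfolding polar_density_def[abs_def] by simp
  have "(LINT x|?T. polar_density M \<mu> x * indicator A x) =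
     (LINT x|?T. enn2real (RN_deriv ?T (positive_variation M \<mu>) x) * indicator A x)
     - (LINT x|?T. enn2real (RN_deriv ?T (negative_variation M \<mu>) x) * indicator A x)"
    unfolding polar_density_def left_diff_distrib
    using p(1) n(1) A' by (intro Bochner_Integration.integral_diff integrable_real_mult_indicator) simp_all
  also have "\<dots> = \<mu> A"
    using p(2) n(2) jordan_decomposition[OF \<mu> A] by simp
  finally show "(LINT x|?T. polar_density M \<mu> x * indicator A x) = \<mu> A" .
qed

text \<open>
  Intersecting with the space, rather than taking an interval that depends on \<open>x\<close>, makes this a
  monotone function on the whole line.
\<close>

definition cumulative :: "real measure \<Rightarrow> real \<Rightarrow> real" where
  "cumulative \<rho> x = measure \<rho> (space \<rho> \<inter> {..x})"

text \<open>
  Minus the primitive of \<open>k\<close> on the unit interval that vanishes at the right end, extended to the line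
  by constants. When \<open>k\<close> is the right-hand side of the equation, this is the flux
  \<open>u' / sqrt (1 + u'\<^sup>2)\<close>.
\<close>

definition tail :: "(real \<Rightarrow> real) \<Rightarrow> real \<Rightarrow> real" where
  "tail k y = (LINT x|leb01. k x * indicator {y..} x)"

lemma cumulative_nonneg: "0 \<le> cumulative \<rho> x"
  by (simp add: cumulative_def)

lemma cumulative_le: "finite_measure \<rho> \<Longrightarrow> cumulative \<rho> x \<le> measure \<rho> (space \<rho>)"
  unfolding cumulative_def by (rule finite_measure.bounded_measure)

lemma borel_measurable_cumulative:
  assumes "finite_measure \<rho>" "sets \<rho> = sets bor01"
  shows "cumulative \<rho> \<in> borel_measurable borel"
proof -
  interpret finite_measure \<rho> by fact
  have [measurable]: "space \<rho> \<inter> {..x} \<in> sets \<rho>" for x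
    using assms(2) sets_eq_imp_space_eq[OF assms(2)] by (auto simp: sets_restrict_space space_restrict_space)
  have "mono (cumulative \<rho>)"
    unfolding cumulative_def by (intro monoI finite_measure_mono) auto
  then show ?thesis by (rule borel_measurable_mono)
qed

lemma borel_measurable_leb01:
  "f \<in> borel_measurable borel \<Longrightarrow> f \<in> borel_measurable leb01"
  by (intro measurable_restrict_space1 measurable_completion) simp

lemma integrable_leb01_bounded:
  assumes "f \<in> borel_measurable leb01" "AE x in leb01. \<bar>f x\<bar> \<le> K"
  shows "integrable leb01 (f :: real \<Rightarrow> real)"
  using assms by (intro finite_measure.integrable_const_bound[OF finite_measure_leb01, of _ K]) auto

lemma integrable_cumulative:
  assumes "finite_measure \<rho>" "sets \<rho> = sets bor01"
  shows "integrable leb01 (cumulative \<rho>)"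
  by (rule integrable_leb01_bounded[of _ "measure \<rho> (space \<rho>)"])
    (simp_all add: borel_measurable_cumulative[OF assms] borel_measurable_leb01
      cumulative_le[OF assms(1)] cumulative_nonneg abs_of_nonneg)

text \<open>
  Both sides are the integral of \<open>k x\<close> over all pairs \<open>y \<le> x\<close> with respect to the product of Lebesgue
  measure and \<open>\<rho>\<close>, integrated in the two possible orders.
\<close>

lemma integral_cumulative:
  assumes \<rho>: "finite_measure \<rho>" "sets \<rho> = sets bor01" and k: "integrable leb01 k"
  shows "(LINT x|leb01. k x * cumulative \<rho> x) = (LINT y|\<rho>. tail k y)"
proof -
  interpret \<rho>: finite_measure \<rho> by fact
  interpret L: finite_measure leb01 by (rule finite_measure_leb01)
  interpret P: pair_sigma_finite leb01 \<rho> ..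
  have sp: "space \<rho> = {0<..<1}"
    using sets_eq_imp_space_eq[OF \<rho>(2)] by (simp add: space_restrict_space)
  have [measurable]: "k \<in> borel_measurable leb01" using k by auto
  have [measurable]: "(\<lambda>x. x) \<in> borel_measurable leb01"
    by (rule borel_measurable_leb01) simp
  have [measurable]: "(\<lambda>x. x) \<in> borel_measurable \<rho>"
    using measurable_restrict_space1[of "\<lambda>x. x" borel borel "{0<..<1}"] \<rho>(2)
    by (simp cong: measurable_cong_sets)
  have S: "space \<rho> \<inter> {..x} \<in> sets \<rho>" for x
    using \<rho>(2) sp by (auto simp: sets_restrict_space)
  have inner: "(LINT y|\<rho>. k x * indicator {y..} x) = k x * cumulative \<rho> x" for x
  proof -
    have "(LINT y|\<rho>. k x * indicator {y..} x) = (LINT y|\<rho>. k x * indicator (space \<rho> \<inter> {..x}) y)"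
      by (intro Bochner_Integration.integral_cong) (auto split: split_indicator)
    then show ?thesis using S by (simp add: cumulative_def)
  qed
  have meas: "(\<lambda>(x, y). k x * indicator {y..} x) \<in> borel_measurable (leb01 \<Otimes>\<^sub>M \<rho>)"
  proof -
    have "(\<lambda>(x, y). k x * indicator {y..} x) = (\<lambda>p. k (fst p) * (if snd p \<le> fst p then 1 else 0))"
      by (auto simp: fun_eq_iff split: split_indicator)
    also have "\<dots> \<in> borel_measurable (leb01 \<Otimes>\<^sub>M \<rho>)" by measurable
    finally show ?thesis .
  qed
  have int: "integrable (leb01 \<Otimes>\<^sub>M \<rho>) (\<lambda>(x, y). k x * indicator {y..} x)"
  proof (rule P.Fubini_integrable[OF meas])
    have "(\<lambda>x. LINT y|\<rho>. norm (case (x, y) of (x, y) \<Rightarrow> k x * indicator {y..} x)) =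
       (\<lambda>x. \<bar>k x\<bar> * cumulative \<rho> x)"
    proof
      fix x
      have "(LINT y|\<rho>. norm (case (x, y) of (x, y) \<Rightarrow> k x * indicator {y..} x)) =
          (LINT y|\<rho>. \<bar>k x\<bar> * indicator (space \<rho> \<inter> {..x}) y)"
        by (intro Bochner_Integration.integral_cong) (auto split: split_indicator)
      then show "(LINT y|\<rho>. norm (case (x, y) of (x, y) \<Rightarrow> k x * indicator {y..} x)) = \<bar>k x\<bar> * cumulative \<rho> x"
        using S by (simp add: cumulative_def)
    qed
    moreover have "integrable leb01 (\<lambda>x. \<bar>k x\<bar> * cumulative \<rho> x)"
    proof (rule Bochner_Integration.integrable_bound)
      show "integrable leb01 (\<lambda>x. k x * measure \<rho> (space \<rho>))" using k by simp
      show "(\<lambda>x. \<bar>k x\<bar> * cumulative \<rho> x) \<in> borel_measurable leb01"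
        using borel_measurable_leb01[OF borel_measurable_cumulative[OF \<rho>]] by measurable
      show "AE x in leb01. norm (\<bar>k x\<bar> * cumulative \<rho> x) \<le> norm (k x * measure \<rho> (space \<rho>))"
        using cumulative_le[OF \<rho>(1)] cumulative_nonneg
        by (intro AE_I2) (simp add: abs_mult mult_left_mono)
    qed
    ultimately show "integrable leb01 (\<lambda>x. LINT y|\<rho>. norm (case (x, y) of (x, y) \<Rightarrow> k x * indicator {y..} x))"
      by simp
    show "AE x in leb01. integrable \<rho> (\<lambda>y. case (x, y) of (x, y) \<Rightarrow> k x * indicator {y..} x)"
    proof (intro AE_I2)
      fix x
      have "integrable \<rho> (\<lambda>y. k x * indicator (space \<rho> \<inter> {..x}) y)"
        using S by (intro integrable_mult_right integrable_real_indicator) (simp_all add: \<rho>.emeasure_eq_measure)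
      moreover have "integrable \<rho> (\<lambda>y. k x * indicator (space \<rho> \<inter> {..x}) y) \<longleftrightarrow>
         integrable \<rho> (\<lambda>y. case (x, y) of (x, y) \<Rightarrow> k x * indicator {y..} x)"
        by (intro Bochner_Integration.integrable_cong refl) (auto split: split_indicator)
      ultimately show "integrable \<rho> (\<lambda>y. case (x, y) of (x, y) \<Rightarrow> k x * indicator {y..} x)" by simp
    qed
  qed
  show ?thesis
    unfolding tail_def P.Fubini_integral[OF int] inner ..
qed

lemma integral_leb01_lborel:
  assumes "f \<in> borel_measurable borel"
  shows "(LINT x|leb01. f x) = (LINT x|lborel. indicator {0<..<1} x * f x :: real)"
proof -
  have "(LINT x|leb01. f x) = (LINT x|lebesgue. indicator {0<..<1} x *\<^sub>R f x)"
    by (rule integral_restrict_space) simp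
  also have "\<dots> = (LINT x|lborel. indicator {0<..<1} x *\<^sub>R f x)"
    by (rule integral_completion) (use assms in measurable)
  finally show ?thesis by simp
qed

lemma test_functionD:
  assumes "test_function \<phi>"
  shows "(\<phi> has_real_derivative deriv \<phi> x) (at x)" "continuous_on UNIV (deriv \<phi>)"
    "continuous_on UNIV \<phi>" "x \<le> 0 \<or> 1 \<le> x \<Longrightarrow> \<phi> x = 0"
    "\<exists>B. \<forall>x. \<bar>\<phi> x\<bar> \<le> B" "\<exists>B. \<forall>x\<in>{0..1}. \<bar>deriv \<phi> x\<bar> \<le> B"
proof -
  obtain D where D: "\<And>x. (\<phi> has_vector_derivative D x) (at x)" "continuous_on UNIV D"
    using assms unfolding test_function_def C1_differentiable_on_def by auto
  then have D': "(\<phi> has_real_derivative D x) (at x)" for x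
    by (simp add: has_real_derivative_iff_has_vector_derivative)
  then have "deriv \<phi> = D" using DERIV_imp_deriv by blast
  then show d: "(\<phi> has_real_derivative deriv \<phi> x) (at x)"
    and c': "continuous_on UNIV (deriv \<phi>)" using D' D by auto
  show c: "continuous_on UNIV \<phi>"
    using D' by (meson DERIV_isCont continuous_at_imp_continuous_on)
  show 0: "x \<le> 0 \<or> 1 \<le> x \<Longrightarrow> \<phi> x = 0" for x
    using assms unfolding test_function_def by force
  have "bounded (\<phi> ` {0..1})" "bounded (deriv \<phi> ` {0..1})"
    by (intro compact_imp_bounded compact_continuous_image continuous_on_subset[OF c]
       continuous_on_subset[OF c'] compact_Icc subset_UNIV)+
  then obtain B B' where B: "\<forall>x\<in>{0..1}. \<bar>\<phi> x\<bar> \<le> B" "\<forall>x\<in>{0..1}. \<bar>deriv \<phi> x\<bar> \<le> B'"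
    by (auto simp: bounded_iff)
  then show "\<exists>B. \<forall>x\<in>{0..1}. \<bar>deriv \<phi> x\<bar> \<le> B" by blast
  have "\<bar>\<phi> x\<bar> \<le> max B 0" for x
  proof (cases "x \<in> {0..1}")
    case False then show ?thesis using 0[of x] by auto
  qed (use B in force)
  then show "\<exists>B. \<forall>x. \<bar>\<phi> x\<bar> \<le> B" by blast
qed

lemma integrable_deriv_test:
  assumes "test_function \<phi>" shows "integrable leb01 (deriv \<phi>)"
proof -
  obtain B where "\<forall>x\<in>{0..1}. \<bar>deriv \<phi> x\<bar> \<le> B" using test_functionD(6)[OF assms] by blast
  then show ?thesis
    using test_functionD(2)[OF assms]
    by (intro integrable_leb01_bounded[of _ B] borel_measurable_leb01 borel_measurable_continuous_onI AE_I2)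
      (auto simp: space_restrict_space)
qed

lemma tail_deriv:
  assumes "test_function \<phi>" "0 \<le> y" "y < 1"
  shows "tail (deriv \<phi>) y = - \<phi> y"
proof -
  have m: "deriv \<phi> \<in> borel_measurable borel"
    using test_functionD(2)[OF assms(1)] by (rule borel_measurable_continuous_onI)
  have "tail (deriv \<phi>) y = (LINT x|lborel. indicator {0<..<1} x * (deriv \<phi> x * indicator {y..} x))"
    unfolding tail_def by (rule integral_leb01_lborel) (use m in measurable)
  also have "\<dots> = (LINT x|lborel. deriv \<phi> x * indicator {y..1} x)"
  proof (rule integral_cong_AE)
    show "AE x in lborel. indicator {0<..<1} x * (deriv \<phi> x * indicator {y..} x) = deriv \<phi> x * indicator {y..1} x"
      using AE_lborel_singleton[of "0::real"] AE_lborel_singleton[of "1::real"]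
      by eventually_elim (use assms in \<open>auto split: split_indicator\<close>)
  qed (use m in measurable)
  also have "\<dots> = \<phi> 1 - \<phi> y"
  proof (rule integral_FTC_Icc_real)
    show "isCont (deriv \<phi>) x" for x
      using test_functionD(2)[OF assms(1)] by (simp add: continuous_on_eq_continuous_at)
  qed (use assms test_functionD(1)[OF assms(1)] in auto)
  finally show ?thesis using test_functionD(4)[OF assms(1), of 1] by simp
qed

lemma integral_cumulative_deriv:
  assumes "finite_measure \<rho>" "sets \<rho> = sets bor01" "test_function \<phi>"
  shows "(LINT x|leb01. cumulative \<rho> x * deriv \<phi> x) = - (LINT y|\<rho>. \<phi> y)"
proof -
  have sp: "space \<rho> = {0<..<1}"
    using sets_eq_imp_space_eq[OF assms(2)] by (simp add: space_restrict_space)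
  have "(LINT x|leb01. cumulative \<rho> x * deriv \<phi> x) = (LINT y|\<rho>. tail (deriv \<phi>) y)"
    using integral_cumulative[OF assms(1,2) integrable_deriv_test[OF assms(3)]]
    by (simp add: mult.commute)
  also have "\<dots> = (LINT y|\<rho>. - \<phi> y)"
    by (intro Bochner_Integration.integral_cong) (simp_all add: sp tail_deriv[OF assms(3)])
  finally show ?thesis by simp
qed

text \<open>
  The source of all nonconstant test functions used below: by Fubini and
  \<open>tail (deriv \<phi>) = - \<phi>\<close>, the distribution function of \<open>\<rho>\<close> has derivative \<open>\<rho>\<close>.
\<close>

lemma BV_deriv_cumulative:
  assumes "finite_measure \<rho>" "sets \<rho> = sets bor01"
  shows "BV_deriv (cumulative \<rho>) (measure \<rho>)"
  unfolding BV_deriv_def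
  using integrable_cumulative[OF assms] finite_signed_measure_measure[OF assms]
    integral_cumulative_deriv[OF assms] signed_integral_measure[OF assms] by simp

section \<open>Primitives of bounded functions\<close>

lemma measurable_indicator_atLeast [measurable]:
  "(indicator {y..} :: real \<Rightarrow> real) \<in> borel_measurable leb01"
  by (rule borel_measurable_leb01) simp

lemma AE_leb01I: "AE x in lborel. 0 < x \<and> x < 1 \<longrightarrow> P x \<Longrightarrow> AE x in leb01. P x"
  using AE_completion[of "\<lambda>x. 0 < x \<and> x < 1 \<longrightarrow> P x" lborel] by (subst AE_restrict_space_iff) auto

lemma integrable_mult_indicator_leb01:
  assumes "integrable leb01 k" "A \<in> sets borel"
  shows "integrable leb01 (\<lambda>x. k x * indicator A x :: real)"
proof (rule Bochner_Integration.integrable_bound[OF assms(1)])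
  have "(indicator A :: real \<Rightarrow> real) \<in> borel_measurable leb01"
    by (rule borel_measurable_leb01) (use assms in simp)
  then show "(\<lambda>x. k x * indicator A x) \<in> borel_measurable leb01"
    using assms(1) by measurable
qed (auto split: split_indicator)

lemma tail_diff:
  assumes "integrable leb01 k" "s \<le> t"
  shows "tail k s - tail k t = (LINT x|leb01. k x * indicator {s..<t} x)"
proof -
  have "tail k s - tail k t = (LINT x|leb01. k x * indicator {s..} x - k x * indicator {t..} x)"
    unfolding tail_def
    by (intro Bochner_Integration.integral_diff[symmetric] integrable_mult_indicator_leb01 assms(1)) auto
  also have "\<dots> = (LINT x|leb01. k x * indicator {s..<t} x)"
    using assms(2) by (intro Bochner_Integration.integral_cong) (auto split: split_indicator)
  finally show ?thesis .
qed

lemma integral_indicator_interval_le: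
  assumes "s \<le> t"
  shows "(LINT x|leb01. indicator {s..<t} x) \<le> t - s"
proof -
  have "(LINT x|leb01. indicator {s..<t} x :: real) = (LINT x|lborel. indicator {0<..<1} x * indicator {s..<t} x)"
    by (rule integral_leb01_lborel) simp
  also have "\<dots> \<le> (LINT x|lborel. indicator {s..<t} x)"
    by (rule integral_mono') (auto split: split_indicator intro!: integrable_real_indicator simp: emeasure_lborel_Ico assms)
  also have "\<dots> = t - s" using assms by simp
  finally show ?thesis .
qed

lemma integral_indicator_bound:
  assumes "integrable leb01 k" "s \<le> t" "AE x in leb01. s \<le> x \<and> x < t \<longrightarrow> \<bar>k x\<bar> \<le> K" "0 \<le> K"
  shows "\<bar>LINT x|leb01. k x * indicator {s..<t} x\<bar> \<le> K * (t - s)"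
proof -
  have int: "integrable leb01 (\<lambda>x. k x * indicator {s..<t} x)"
    by (rule integrable_mult_indicator_leb01[OF assms(1)]) simp
  have "\<bar>LINT x|leb01. k x * indicator {s..<t} x\<bar> \<le> (LINT x|leb01. \<bar>k x * indicator {s..<t} x\<bar>)"
    by (rule integral_abs_bound)
  also have "\<dots> \<le> (LINT x|leb01. K * indicator {s..<t} x)"
  proof (rule integral_mono_AE)
    show "integrable leb01 (\<lambda>x. K * indicator {s..<t} x)"
      by (intro integrable_mult_indicator_leb01 finite_measure.integrable_const finite_measure_leb01) simp
    show "AE x in leb01. \<bar>k x * indicator {s..<t} x\<bar> \<le> K * indicator {s..<t} x"
      using assms(3) by eventually_elim (auto split: split_indicator)
  qed (use int in simp)
  also have "\<dots> \<le> K * (t - s)"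
    using integral_indicator_interval_le[OF assms(2)] assms(4) by (simp add: mult_left_mono)
  finally show ?thesis .
qed

lemma tail_lipschitz:
  assumes "k \<in> borel_measurable leb01" "AE x in leb01. \<bar>k x\<bar> \<le> K" "0 \<le> K"
  shows "\<bar>tail k s - tail k t\<bar> \<le> K * \<bar>s - t\<bar>"
proof -
  have k: "integrable leb01 k" by (rule integrable_leb01_bounded[OF assms(1,2)])
  have "\<bar>tail k s - tail k t\<bar> \<le> K * (t - s)" if "s \<le> t" for s t
    unfolding tail_diff[OF k that]
    by (rule integral_indicator_bound[OF k that _ assms(3)]) (use assms(2) in eventually_elim, auto)
  from this[of s t] this[of t s] show ?thesis
    by (cases "s \<le> t") (auto simp: abs_minus_commute)
qed

lemma tail_ge_1: "1 \<le> y \<Longrightarrow> tail k y = 0"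
proof -
  assume "1 \<le> y"
  then have "tail k y = (LINT x|leb01. 0)"
    unfolding tail_def by (intro Bochner_Integration.integral_cong) (auto simp: space_restrict_space split: split_indicator)
  then show ?thesis by simp
qed

lemma tail_le_0: "y \<le> 0 \<Longrightarrow> tail k y = (LINT x|leb01. k x)"
  unfolding tail_def by (intro Bochner_Integration.integral_cong) (auto simp: space_restrict_space split: split_indicator)

lemma continuous_on_tail:
  assumes "k \<in> borel_measurable leb01" "AE x in leb01. \<bar>k x\<bar> \<le> K" "0 \<le> K"
  shows "continuous_on UNIV (tail k)"
proof -
  have "K-lipschitz_on UNIV (tail k)"
    by (rule lipschitz_onI) (use tail_lipschitz[OF assms] assms(3) in \<open>auto simp: dist_real_def\<close>)
  then show ?thesis by (rule lipschitz_on_continuous_on)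
qed

lemma MVT_segment:
  fixes g :: "real \<Rightarrow> real"
  assumes "\<And>x. x \<in> closed_segment a b \<Longrightarrow> (g has_real_derivative g' x) (at x)"
  shows "\<exists>\<xi>\<in>closed_segment a b. g a - g b = g' \<xi> * (a - b)"
proof -
  consider "a = b" | "a < b" | "b < a" by linarith
  then show ?thesis
  proof cases
    case 2
    then obtain \<xi> where "a < \<xi>" "\<xi> < b" "g b - g a = (b - a) * g' \<xi>"
      using MVT2[of a b g g'] assms by (auto simp: closed_segment_eq_real_ivl)
    then show ?thesis using 2
      by (intro bexI[of _ \<xi>]) (auto simp: closed_segment_eq_real_ivl algebra_simps)
  next
    case 3
    then obtain \<xi> where "b < \<xi>" "\<xi> < a" "g a - g b = (a - b) * g' \<xi>"
      using MVT2[of b a g g'] assms by (auto simp: closed_segment_eq_real_ivl)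
    then show ?thesis using 3
      by (intro bexI[of _ \<xi>]) (auto simp: closed_segment_eq_real_ivl algebra_simps)
  qed auto
qed

lemma has_real_derivative_zeroI:
  fixes h :: "real \<Rightarrow> real"
  assumes "\<And>e. 0 < e \<Longrightarrow> \<exists>d>0. \<forall>s. \<bar>s - t\<bar> < d \<longrightarrow> \<bar>h s - h t\<bar> \<le> e * \<bar>s - t\<bar>"
  shows "(h has_real_derivative 0) (at t)"
proof -
  have "(h has_derivative (\<lambda>_. 0)) (at t)"
    unfolding has_derivative_within_alt using assms by (auto simp: dist_real_def bounded_linear_zero)
  moreover have "(*) (0::real) = (\<lambda>_. 0)" by auto
  ultimately show ?thesis unfolding has_field_derivative_def by simp
qed

text \<open>
  The chain rule for the Lipschitz function \<open>tail k\<close>, without differentiating it almost everywhere.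
  The difference \<open>H\<close> of the two sides satisfies \<open>H b - H a = o(b - a)\<close> at every point: by the mean
  value theorem its increment is the integral over \<open>[a,b)\<close> of \<open>k\<close> times a difference of two values of
  \<open>G'\<close> at points close to each other. Hence \<open>H\<close> has derivative zero everywhere and is constant.
\<close>

lemma tail_chain_rule:
  assumes k: "k \<in> borel_measurable leb01" "AE x in leb01. \<bar>k x\<bar> \<le> K" "0 \<le> K"
    and S: "convex S" "open S" "\<And>y. tail k y \<in> S"
    and G: "\<And>s. s \<in> S \<Longrightarrow> (G has_real_derivative G' s) (at s)" "continuous_on S G'"
    and w: "integrable leb01 (\<lambda>x. G' (tail k x) * k x)"
  shows "G (tail k y) = G 0 + tail (\<lambda>x. G' (tail k x) * k x) y"
proof -
  let ?F = "tail k" and ?w = "\<lambda>x. G' (tail k x) * k x"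
  let ?H = "\<lambda>y. G (?F y) - tail ?w y"
  have kint: "integrable leb01 k" by (rule integrable_leb01_bounded[OF k(1,2)])
  have "(?H has_real_derivative 0) (at t)" for t
  proof (rule has_real_derivative_zeroI)
    fix e :: real assume e: "0 < e"
    define e' where "e' = e / (2 * K + 1)"
    have e': "0 < e'" "2 * e' * K \<le> e"
      using e k(3) by (auto simp: e'_def field_simps)
    have "isCont G' (?F t)"
      using G(2) S(2,3) by (simp add: continuous_on_eq_continuous_at)
    then obtain d where d: "d > 0" "\<And>s. \<bar>s - ?F t\<bar> < d \<Longrightarrow> \<bar>G' s - G' (?F t)\<bar> < e'"
      using e'(1) unfolding continuous_at_eps_delta by (auto simp: dist_real_def)
    \<comment> \<open>on the \<open>d'\<close>-neighbourhood of \<open>t\<close> the values of \<open>tail k\<close> stay \<open>d\<close>-close to the one at \<open>t\<close>\<close>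
    define d' where "d' = d / (K + 1)"
    have d': "0 < d'" "K * d' < d"
      using d(1) k(3) by (auto simp: d'_def field_simps)
    have near: "\<bar>?F x - ?F t\<bar> < d" if "\<bar>x - t\<bar> < d'" for x
    proof -
      have "\<bar>?F x - ?F t\<bar> \<le> K * \<bar>x - t\<bar>" by (rule tail_lipschitz[OF k])
      also have "\<dots> \<le> K * d'" using that k(3) by (intro mult_left_mono) auto
      finally show ?thesis using d'(2) by simp
    qed
    have main: "\<bar>?H a - ?H b\<bar> \<le> e * (b - a)" if ab: "a \<le> b" "\<bar>a - t\<bar> < d'" "\<bar>b - t\<bar> < d'" for a b
    proof -
      have seg: "closed_segment (?F a) (?F b) \<subseteq> S"
        using S by (intro closed_segment_subset) auto
      obtain \<xi> where \<xi>: "\<xi> \<in> closed_segment (?F a) (?F b)" "G (?F a) - G (?F b) = G' \<xi> * (?F a - ?F b)"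
        using MVT_segment[of "?F a" "?F b" G G'] G(1) seg by blast
      have "\<bar>\<xi> - ?F t\<bar> < d"
        using \<xi>(1) near[OF ab(2)] near[OF ab(3)] by (auto simp: closed_segment_eq_real_ivl split: if_splits)
      then have \<xi>': "\<bar>G' \<xi> - G' (?F t)\<bar> < e'" by (rule d(2))
      have "?H a - ?H b = G' \<xi> * (?F a - ?F b) - (tail ?w a - tail ?w b)" using \<xi>(2) by simp
      also have "\<dots> = (LINT x|leb01. G' \<xi> * (k x * indicator {a..<b} x)) - (LINT x|leb01. ?w x * indicator {a..<b} x)"
        unfolding tail_diff[OF kint ab(1)] tail_diff[OF w ab(1)] by simp
      also have "\<dots> = (LINT x|leb01. G' \<xi> * (k x * indicator {a..<b} x) - ?w x * indicator {a..<b} x)"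
        by (intro Bochner_Integration.integral_diff[symmetric] integrable_mult_right
            integrable_mult_indicator_leb01 kint w) auto
      also have "\<dots> = (LINT x|leb01. (G' \<xi> * k x - ?w x) * indicator {a..<b} x)"
        by (intro Bochner_Integration.integral_cong) (auto simp: algebra_simps)
      finally have "\<bar>?H a - ?H b\<bar> = \<bar>LINT x|leb01. (G' \<xi> * k x - ?w x) * indicator {a..<b} x\<bar>" by simp
      also have "\<dots> \<le> (2 * e' * K) * (b - a)"
      proof (rule integral_indicator_bound[OF _ ab(1)])
        show "integrable leb01 (\<lambda>x. G' \<xi> * k x - ?w x)" using kint w by simp
        show "AE x in leb01. a \<le> x \<and> x < b \<longrightarrow> \<bar>G' \<xi> * k x - ?w x\<bar> \<le> 2 * e' * K"
          using k(2)
        proof eventually_elim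
          case (elim x)
          show ?case
          proof
            assume "a \<le> x \<and> x < b"
            then have "\<bar>x - t\<bar> < d'" using ab by auto
            then have "\<bar>G' (?F x) - G' (?F t)\<bar> < e'" by (intro d(2) near)
            then have "\<bar>G' \<xi> - G' (?F x)\<bar> \<le> 2 * e'" using \<xi>' by linarith
            then have "\<bar>G' \<xi> - G' (?F x)\<bar> * \<bar>k x\<bar> \<le> 2 * e' * K"
              using elim e'(1) by (intro mult_mono) auto
            then show "\<bar>G' \<xi> * k x - ?w x\<bar> \<le> 2 * e' * K"
              by (simp add: abs_mult[symmetric] left_diff_distrib)
          qed
        qed
      qed (use e'(1) k(3) in auto)
      also have "\<dots> \<le> e * (b - a)" using e'(2) ab(1) by (intro mult_right_mono) auto
      finally show ?thesis .
    qed
    show "\<exists>d>0. \<forall>s. \<bar>s - t\<bar> < d \<longrightarrow> \<bar>?H s - ?H t\<bar> \<le> e * \<bar>s - t\<bar>"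
    proof (intro exI[of _ d'] conjI allI impI)
      fix s assume "\<bar>s - t\<bar> < d'"
      then show "\<bar>?H s - ?H t\<bar> \<le> e * \<bar>s - t\<bar>"
        using main[of s t] main[of t s] d'(1) by (cases "s \<le> t") (auto simp: abs_minus_commute)
    qed (rule d'(1))
  qed
  then have "?H y = ?H 1"
    using DERIV_isconst_all[of ?H] by blast
  then show ?thesis by (simp add: tail_ge_1)
qed

section \<open>Absolutely continuous measures\<close>

text \<open>
  The measure \<open>h dx\<close>. The image under the identity restricts it from the Lebesgue sets to the Borel
  sets, on which the signed measures live.
\<close>

definition lebesgue_density :: "(real \<Rightarrow> real) \<Rightarrow> real measure" where
  "lebesgue_density h = distr (density leb01 (\<lambda>x. ennreal (h x))) bor01 (\<lambda>x. x)"

lemma sets_lebesgue_density [simp, measurable_cong]: "sets (lebesgue_density h) = sets bor01"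
  by (simp add: lebesgue_density_def)

lemma measurable_id_leb01_bor01: "(\<lambda>x. x) \<in> leb01 \<rightarrow>\<^sub>M bor01"
  by (rule measurable_restrict_space2) (auto simp: space_restrict_space intro!: borel_measurable_leb01)

lemma integral_lebesgue_density:
  assumes "integrable leb01 h" "\<And>x. 0 \<le> h x" and f: "f \<in> borel_measurable bor01"
  shows "(LINT x|lebesgue_density h. f x) = (LINT x|leb01. h x * f x :: real)"
proof -
  have [measurable]: "f \<in> borel_measurable leb01"
    using measurable_compose[OF measurable_id_leb01_bor01 f] .
  have [measurable]: "h \<in> borel_measurable leb01" using assms by auto
  have "(LINT x|lebesgue_density h. f x) = (LINT x|density leb01 (\<lambda>x. ennreal (h x)). f x)"
    unfolding lebesgue_density_def
    by (rule integral_distr) (use measurable_id_leb01_bor01 f in \<open>simp_all\<close>)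
  also have "\<dots> = (LINT x|leb01. h x *\<^sub>R f x)"
    by (rule integral_density) (use assms in auto)
  finally show ?thesis by simp
qed

lemma sets_bor01_iff: "A \<in> sets bor01 \<longleftrightarrow> A \<in> sets borel \<and> A \<subseteq> {0<..<1}"
  by (auto simp: sets_restrict_space_iff)

lemma finite_measure_lebesgue_density:
  assumes h: "integrable leb01 h" "\<And>x. 0 \<le> h x"
  shows "finite_measure (lebesgue_density h)"
proof (rule finite_measureI)
  have "(\<integral>\<^sup>+x. ennreal (h x) \<partial>leb01) < \<infinity>"
    using h by (simp add: nn_integral_eq_integral)
  moreover have "emeasure (lebesgue_density h) (space (lebesgue_density h)) \<le> (\<integral>\<^sup>+x. ennreal (h x) \<partial>leb01)"
    using h measurable_id_leb01_bor01 unfolding lebesgue_density_def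
    by (subst emeasure_distr)
      (auto simp: emeasure_density sets_bor01_iff intro!: nn_integral_mono split: split_indicator)
  ultimately show "emeasure (lebesgue_density h) (space (lebesgue_density h)) \<noteq> \<infinity>"
    by (auto simp: top_unique)
qed

lemma measure_lebesgue_density:
  assumes h: "integrable leb01 h" "\<And>x. 0 \<le> h x" and A: "A \<in> sets bor01"
  shows "measure (lebesgue_density h) A = (LINT x|leb01. h x * indicator A x)"
proof -
  interpret finite_measure "lebesgue_density h" by (rule finite_measure_lebesgue_density[OF h])
  have "(LINT x|lebesgue_density h. indicator A x) = (LINT x|leb01. h x * indicator A x)"
    by (rule integral_lebesgue_density[OF h]) (use A in simp)
  then show ?thesis using A by simp
qed

lemma cumulative_lebesgue_density:
  assumes h: "integrable leb01 h" "\<And>x. 0 \<le> h x"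
  shows "cumulative (lebesgue_density h) y = (LINT x|leb01. h x) - tail h y"
proof -
  have sp: "space (lebesgue_density h) \<inter> {..y} \<in> sets bor01"
    by (auto simp: sets_bor01_iff lebesgue_density_def space_restrict_space)
  have ne: "AE x in leb01. x \<noteq> y"
    by (rule AE_leb01I) (use AE_lborel_singleton[of y] in eventually_elim, simp)
  have "cumulative (lebesgue_density h) y = (LINT x|leb01. h x * indicator (space (lebesgue_density h) \<inter> {..y}) x)"
    unfolding cumulative_def by (rule measure_lebesgue_density[OF h sp])
  also have "\<dots> = (LINT x|leb01. h x - h x * indicator {y..} x)"
  proof (rule integral_cong_AE)
    show "AE x in leb01. h x * indicator (space (lebesgue_density h) \<inter> {..y}) x = h x - h x * indicator {y..} x"
      using ne AE_space[of leb01] by eventually_elim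
        (auto simp: lebesgue_density_def space_restrict_space split: split_indicator)
    show "(\<lambda>x. h x * indicator (space (lebesgue_density h) \<inter> {..y}) x) \<in> borel_measurable leb01"
      by (rule borel_measurable_integrable[OF integrable_mult_indicator_leb01[OF h(1)]])
        (use sp in \<open>simp add: sets_bor01_iff\<close>)
  qed (use h in measurable)
  also have "\<dots> = (LINT x|leb01. h x) - tail h y"
    unfolding tail_def by (intro Bochner_Integration.integral_diff integrable_mult_indicator_leb01 h) simp
  finally show ?thesis .
qed

section \<open>Weak derivatives and the lemma of du Bois-Reymond\<close>

text \<open>
  The positive and the negative part of \<open>k\<close> are densities of finite measures, and \<open>tail k\<close> is, up to a
  constant, the difference of their distribution functions.
\<close>

lemma weak_deriv_tail:
  assumes k: "integrable leb01 k"
  shows "weak_deriv (tail k) (\<lambda>x. - k x)"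
proof -
  define p n where "p = (\<lambda>x. max 0 (k x))" and "n = (\<lambda>x. max 0 (- k x))"
  have int: "integrable leb01 p" "integrable leb01 n" using k by (auto simp: p_def n_def)
  have nn: "\<And>x. 0 \<le> p x" "\<And>x. 0 \<le> n x" by (auto simp: p_def n_def)
  have pn: "k = (\<lambda>x. p x - n x)" by (auto simp: p_def n_def fun_eq_iff)
  note fp = finite_measure_lebesgue_density[OF int(1) nn(1)] and fn = finite_measure_lebesgue_density[OF int(2) nn(2)]
  define c where "c = (LINT x|leb01. k x)"
  have c: "c = (LINT x|leb01. p x) - (LINT x|leb01. n x)"
    unfolding c_def pn by (rule Bochner_Integration.integral_diff[OF int])
  have tail: "tail k = (\<lambda>y. c - cumulative (lebesgue_density p) y + cumulative (lebesgue_density n) y)"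
  proof
    fix y
    have "tail k y = tail p y - tail n y"
      unfolding tail_def pn left_diff_distrib
      by (intro Bochner_Integration.integral_diff integrable_mult_indicator_leb01 int) auto
    then show "tail k y = c - cumulative (lebesgue_density p) y + cumulative (lebesgue_density n) y"
      by (simp add: cumulative_lebesgue_density[OF int(1) nn(1)] cumulative_lebesgue_density[OF int(2) nn(2)] c)
  qed
  have tint: "integrable leb01 (tail k)"
    unfolding tail
    by (intro Bochner_Integration.integrable_add Bochner_Integration.integrable_diff
        finite_measure.integrable_const finite_measure_leb01
        integrable_cumulative[OF fp] integrable_cumulative[OF fn] sets_lebesgue_density)
  have "(LINT x|leb01. tail k x * deriv \<phi> x) = - (LINT x|leb01. - k x * \<phi> x)" if \<phi>: "test_function \<phi>" for \<phi>
  proof -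
    have d: "integrable leb01 (deriv \<phi>)" by (rule integrable_deriv_test[OF \<phi>])
    have m: "\<phi> \<in> borel_measurable borel" using test_functionD(3)[OF \<phi>] by (rule borel_measurable_continuous_onI)
    obtain B where B: "\<And>x. \<bar>\<phi> x\<bar> \<le> B" using test_functionD(5)[OF \<phi>] by blast
    have *: "integrable leb01 (\<lambda>x. cumulative (lebesgue_density h) x * deriv \<phi> x)"
      if h: "integrable leb01 h" "\<And>x. 0 \<le> h x" for h
    proof (rule Bochner_Integration.integrable_bound)
      have "finite_measure (lebesgue_density h)" by (rule finite_measure_lebesgue_density[OF h])
      note L = this
      show "integrable leb01 (\<lambda>x. measure (lebesgue_density h) (space (lebesgue_density h)) * deriv \<phi> x)"
        using d by simp
      show "(\<lambda>x. cumulative (lebesgue_density h) x * deriv \<phi> x) \<in> borel_measurable leb01"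
        using borel_measurable_leb01[OF borel_measurable_cumulative[OF L]] d by auto
      show "AE x in leb01. norm (cumulative (lebesgue_density h) x * deriv \<phi> x)
         \<le> norm (measure (lebesgue_density h) (space (lebesgue_density h)) * deriv \<phi> x)"
        using cumulative_le[OF L] cumulative_nonneg by (auto simp: abs_mult intro!: mult_right_mono)
    qed
    have **: "integrable leb01 (\<lambda>x. h x * \<phi> x)" if "integrable leb01 h" for h :: "real \<Rightarrow> real"
    proof (rule Bochner_Integration.integrable_bound)
      show "integrable leb01 (\<lambda>x. B * h x)" using that by simp
      show "(\<lambda>x. h x * \<phi> x) \<in> borel_measurable leb01"
        using that borel_measurable_leb01[OF m] by auto
      have "B \<ge> 0" using B[of 0] by linarith
      then show "AE x in leb01. norm (h x * \<phi> x) \<le> norm (B * h x)"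
        using B by (auto simp: abs_mult mult.commute[of B] intro!: mult_left_mono)
    qed
    have m': "\<phi> \<in> borel_measurable bor01" using m by (rule measurable_restrict_space1)
    have "(LINT x|leb01. deriv \<phi> x) = tail (deriv \<phi>) 0" by (simp add: tail_le_0)
    also have "\<dots> = 0"
      using tail_deriv[OF \<phi>, of 0] test_functionD(4)[OF \<phi>, of 0] by simp
    finally have d0: "(LINT x|leb01. deriv \<phi> x) = 0" .
    have "(LINT x|leb01. tail k x * deriv \<phi> x) =
       (LINT x|leb01. c * deriv \<phi> x - cumulative (lebesgue_density p) x * deriv \<phi> x
          + cumulative (lebesgue_density n) x * deriv \<phi> x)"
      unfolding tail by (intro Bochner_Integration.integral_cong) (auto simp: algebra_simps)
    also have "\<dots> = (LINT x|leb01. c * deriv \<phi> x) - (LINT x|leb01. cumulative (lebesgue_density p) x * deriv \<phi> x)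
          + (LINT x|leb01. cumulative (lebesgue_density n) x * deriv \<phi> x)"
      using *[OF int(1) nn(1)] *[OF int(2) nn(2)] d by simp
    also have "\<dots> = (LINT x|leb01. p x * \<phi> x) - (LINT x|leb01. n x * \<phi> x)"
      using integral_cumulative_deriv[OF fp sets_lebesgue_density \<phi>]
        integral_cumulative_deriv[OF fn sets_lebesgue_density \<phi>] d0
        integral_lebesgue_density[OF int(1) nn(1) m'] integral_lebesgue_density[OF int(2) nn(2) m'] by simp
    also have "\<dots> = (LINT x|leb01. p x * \<phi> x - n x * \<phi> x)"
      using **[OF int(1)] **[OF int(2)] by simp
    also have "\<dots> = (LINT x|leb01. k x * \<phi> x)"
      by (intro Bochner_Integration.integral_cong) (auto simp: pn algebra_simps)
    finally show ?thesis by simp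
  qed
  then show ?thesis unfolding weak_deriv_def using tint k by simp
qed

text \<open>
  Borel sets suffice, since every Lebesgue set is a Borel set up to a null set.
\<close>

lemma AE_leb01_eqI:
  assumes f: "integrable leb01 f" "integrable leb01 f'"
    and eq: "\<And>A. A \<in> sets bor01 \<Longrightarrow> (LINT x|leb01. f x * indicator A x) = (LINT x|leb01. f' x * indicator A x :: real)"
  shows "AE x in leb01. f x = f' x"
proof (rule density_unique_real[OF f])
  fix A assume A: "A \<in> sets leb01"
  then have A': "A \<in> sets lebesgue" "A \<subseteq> {0<..<1}" by (auto simp: sets_restrict_space_iff)
  define B where "B = main_part lborel A"
  have A1: "A = B \<union> null_part lborel A" and B1: "B \<in> sets borel"
    using main_part_null_part_Un[of A lborel] main_part_sets[of A lborel] A'(1) by (auto simp: B_def)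
  obtain N where N: "N \<in> null_sets lborel" "null_part lborel A \<subseteq> N"
    using null_part[of A lborel] A'(1) by auto
  have B: "B \<in> sets bor01" using A1 A'(2) B1 by (auto simp: sets_bor01_iff)
  have ae: "AE x in leb01. indicator A x = (indicator B x :: real)"
    by (rule AE_leb01I) (use AE_not_in[OF N(1)] in eventually_elim, use A1 N(2) in \<open>auto split: split_indicator\<close>)
  have meas: "(\<lambda>x. g x * indicator C x) \<in> borel_measurable leb01"
    if "integrable leb01 g" "C = A \<or> C = B" for g :: "real \<Rightarrow> real" and C
  proof -
    have "C \<in> sets leb01" using that(2) A B by (auto simp: sets_bor01_iff sets_restrict_space_iff)
    then show ?thesis using that(1) by measurable
  qed
  have "(LINT x:A|leb01. g x) = (LINT x|leb01. g x * indicator B x)" if g: "integrable leb01 g" for g :: "real \<Rightarrow> real"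
  proof -
    have "(LINT x:A|leb01. g x) = (LINT x|leb01. g x * indicator A x)"
      by (simp add: set_lebesgue_integral_def mult.commute)
    also have "\<dots> = (LINT x|leb01. g x * indicator B x)"
      by (rule integral_cong_AE) (use meas[OF g] ae in auto)
    finally show ?thesis .
  qed
  then show "(LINT x:A|leb01. f x) = (LINT x:A|leb01. f' x)" using eq[OF B] f by simp
qed

text \<open>
  The hypothesis says that the positive and the negative part of \<open>h\<close> are densities of measures with
  the same distribution function, and a distribution function determines its measure.
\<close>

lemma tail_eq_0_imp_AE:
  assumes h: "integrable leb01 h" and tail: "\<And>y. tail h y = 0"
  shows "AE x in leb01. h x = 0"
proof -
  define p n where "p = (\<lambda>x. max 0 (h x))" and "n = (\<lambda>x. max 0 (- h x))"
  have int: "integrable leb01 p" "integrable leb01 n" using h by (auto simp: p_def n_def)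
  have nn: "\<And>x. 0 \<le> p x" "\<And>x. 0 \<le> n x" by (auto simp: p_def n_def)
  have pn: "h x = p x - n x" for x by (auto simp: p_def n_def)
  let ?B = "\<lambda>g. distr (lebesgue_density g) borel (\<lambda>x. x)"
  have id: "(\<lambda>x. x) \<in> lebesgue_density g \<rightarrow>\<^sub>M borel" for g
    using measurable_restrict_space1[of "\<lambda>x. x" borel borel "{0<..<1}"]
    by (simp cong: measurable_cong_sets)
  have B: "finite_borel_measure (?B g)" "cdf (?B g) y = (LINT x|leb01. g x) - tail g y"
    "measure (?B g) A = measure (lebesgue_density g) A"
    if g: "integrable leb01 g" "\<And>x. 0 \<le> g x" and A: "A \<in> sets bor01" for g y A
  proof -
    interpret finite_measure "lebesgue_density g" by (rule finite_measure_lebesgue_density[OF g])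
    interpret D: finite_measure "?B g" by (rule finite_measure_distr[OF id])
    show "finite_borel_measure (?B g)" by unfold_locales simp
    have "cdf (?B g) y = cumulative (lebesgue_density g) y"
      unfolding cdf_def cumulative_def by (subst measure_distr[OF id]) (auto simp: Int_commute)
    then show "cdf (?B g) y = (LINT x|leb01. g x) - tail g y"
      by (simp add: cumulative_lebesgue_density[OF g])
    have "A \<inter> space (lebesgue_density g) = A"
      using A by (auto simp: sets_bor01_iff lebesgue_density_def space_restrict_space)
    then show "measure (?B g) A = measure (lebesgue_density g) A"
      using A by (subst measure_distr[OF id]) (auto simp: sets_bor01_iff)
  qed
  have t: "tail p y = tail n y" for y
  proof -
    have "tail h y = tail p y - tail n y"
      unfolding tail_def pn left_diff_distrib
      by (intro Bochner_Integration.integral_diff integrable_mult_indicator_leb01 int) auto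
    then show ?thesis using tail by simp
  qed
  have "cdf (?B p) y = cdf (?B n) y" for y
    using t[of y] t[of 0] by (simp add: B(2)[OF int(1) nn(1) sets.empty_sets] B(2)[OF int(2) nn(2) sets.empty_sets] tail_le_0)
  then have eq: "?B p = ?B n"
    by (intro cdf_unique' B(1)[OF int(1) nn(1) sets.empty_sets] B(1)[OF int(2) nn(2) sets.empty_sets]) auto
  have "AE x in leb01. p x = n x"
  proof (rule AE_leb01_eqI[OF int])
    fix A assume A: "A \<in> sets bor01"
    show "(LINT x|leb01. p x * indicator A x) = (LINT x|leb01. n x * indicator A x)"
      using eq B(3)[OF int(1) nn(1) A] B(3)[OF int(2) nn(2) A]
      by (simp add: measure_lebesgue_density[OF int(1) nn(1) A] measure_lebesgue_density[OF int(2) nn(2) A])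
  qed
  then show ?thesis by eventually_elim (simp add: pn)
qed

lemma integral_leb01_support:
  fixes g :: "real \<Rightarrow> real"
  assumes g: "continuous_on UNIV g" and supp: "\<And>x. x \<le> 0 \<or> 1 \<le> x \<Longrightarrow> g x = 0"
  shows "(LINT x|leb01. g x) = integral {-1..1} g"
proof -
  have m: "g \<in> borel_measurable borel" using g by (rule borel_measurable_continuous_onI)
  have "(LINT x|leb01. g x) = (LINT x|lborel. indicator {0<..<1} x * g x)"
    by (rule integral_leb01_lborel[OF m])
  also have "\<dots> = (LINT x:{-1..1}|lborel. g x)"
    unfolding set_lebesgue_integral_def using supp
    by (intro Bochner_Integration.integral_cong) (auto split: split_indicator)
  also have "\<dots> = integral {-1..1} g"
  proof (rule set_borel_integral_eq_integral)
    show "set_integrable lborel {- 1..1} g"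
      unfolding set_integrable_def
      by (intro borel_integrable_compact continuous_on_subset[OF g]) auto
  qed
  finally show ?thesis .
qed

text \<open>
  The primitive from the left vanishes to the right of the support because the integral is zero.
\<close>

lemma test_function_primitive:
  assumes g: "continuous_on UNIV g" and ab: "0 < \<alpha>" "\<alpha> \<le> \<beta>" "\<beta> < 1"
    and supp: "\<And>x. x \<le> \<alpha> \<or> \<beta> \<le> x \<Longrightarrow> g x = 0" and zero: "(LINT x|leb01. g x) = 0"
  shows "\<exists>\<phi>. test_function \<phi> \<and> deriv \<phi> = g"
proof -
  define \<phi> where "\<phi> x = integral {-1..x} g" for x
  have int: "g integrable_on {a..b}" for a b
    by (intro integrable_continuous_real continuous_on_subset[OF g]) simp
  have left: "\<phi> x = 0" if "x \<le> \<alpha>" for x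
  proof -
    have "integral {-1..x} g = integral {-1..x} (\<lambda>_. 0)"
      by (rule integral_cong) (use that supp in auto)
    then show ?thesis by (simp add: \<phi>_def)
  qed
  have right: "\<phi> x = 0" if "\<beta> \<le> x" for x
  proof -
    have "integral {\<beta>..y} g = integral {\<beta>..y} (\<lambda>_. 0)" for y
      by (rule integral_cong) (use supp in auto)
    then have *: "\<phi> y = integral {-1..\<beta>} g" if "\<beta> \<le> y" for y
      using Henstock_Kurzweil_Integration.integral_combine[of "-1" \<beta> y g] int ab that by (simp add: \<phi>_def)
    have "(LINT x|leb01. g x) = integral {-1..1} g"
      by (rule integral_leb01_support[OF g], rule supp) (use ab in auto)
    then have "\<phi> 1 = 0" using zero by (simp add: \<phi>_def)
    then show ?thesis using *[OF that] *[of 1] ab by simp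
  qed
  have d: "(\<phi> has_real_derivative g x) (at x)" for x
  proof -
    consider "x < \<alpha>" | "\<beta> < x" | "-1 < x" "x < 2" using ab by linarith
    then show ?thesis
    proof cases
      case 1
      then have "(\<phi> has_real_derivative 0) (at x)"
        using left by (intro has_field_derivative_transform_within_open[OF DERIV_const[of 0] open_lessThan[of \<alpha>]]) simp_all
      then show ?thesis using supp 1 by simp
    next
      case 2
      then have "(\<phi> has_real_derivative 0) (at x)"
        using right by (intro has_field_derivative_transform_within_open[OF DERIV_const[of 0] open_greaterThan[of \<beta>]]) simp_all
      then show ?thesis using supp 2 by simp
    next
      case 3
      have "(\<phi> has_real_derivative g x) (at x within {-1..2})"
        unfolding \<phi>_def[abs_def] using 3
        by (intro integral_has_real_derivative continuous_on_subset[OF g]) auto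
      moreover have "at x within {-1..2} = at x"
        using 3 by (intro at_within_interior) auto
      ultimately show ?thesis by simp
    qed
  qed
  have "deriv \<phi> = g" using d DERIV_imp_deriv by blast
  moreover have "\<phi> C1_differentiable_on UNIV"
    unfolding C1_differentiable_on_def using d g
    by (auto simp: has_real_derivative_iff_has_vector_derivative intro!: exI[of _ g])
  moreover have "\<exists>K. compact K \<and> K \<subseteq> {0<..<1} \<and> (\<forall>x. x \<notin> K \<longrightarrow> \<phi> x = 0)"
    using left right ab by (intro exI[of _ "{\<alpha>..\<beta>}"]) force
  ultimately show ?thesis unfolding test_function_def by blast
qed

text \<open>
  Continuous functions that for large \<open>n\<close> rise from 0 to 1 on \<open>[1/n, 2/n]\<close>, fall back on \<open>[t - 2/n, t - 1/n]\<close>, and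
  approximate the indicator function of \<open>(0,t)\<close> while keeping a compact support inside that interval.
\<close>

definition trapezoid :: "nat \<Rightarrow> real \<Rightarrow> real \<Rightarrow> real" where
  "trapezoid n t x = max 0 (min 1 (min (real n * x - 1) (real n * (t - x) - 1)))"

lemma trapezoid_simps:
  shows "0 \<le> trapezoid n t x" "trapezoid n t x \<le> 1" "continuous_on UNIV (trapezoid n t)"
    and "0 < n \<Longrightarrow> x \<le> 1 / n \<or> t - 1 / n \<le> x \<Longrightarrow> trapezoid n t x = 0"
proof -
  show "continuous_on UNIV (trapezoid n t)"
    unfolding trapezoid_def[abs_def] by (intro continuous_intros)
  show "trapezoid n t x = 0" if "0 < n" "x \<le> 1 / n \<or> t - 1 / n \<le> x"
  proof -
    have "real n * x - 1 \<le> 0 \<or> real n * (t - x) - 1 \<le> 0"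
      using that by (auto simp: field_simps)
    then show ?thesis unfolding trapezoid_def by (intro max_absorb1) (auto simp: min_le_iff_disj)
  qed
qed (auto simp: trapezoid_def)

lemma trapezoid_tendsto:
  assumes "0 < x"
  shows "(\<lambda>n. trapezoid n t x) \<longlonglongrightarrow> indicator {..<t} x"
proof (cases "x < t")
  case True
  obtain N where N: "2 / x < real N" "2 / (t - x) < real N"
    using reals_Archimedean2[of "max (2 / x) (2 / (t - x))"] by auto
  have "trapezoid n t x = 1" if "N \<le> n" for n
  proof -
    have "2 / x \<le> real n" "2 / (t - x) \<le> real n" using N that by (auto intro: order_trans less_imp_le)
    then have "2 \<le> real n * x" "2 \<le> real n * (t - x)" using assms True by (auto simp: pos_divide_le_eq)
    then show ?thesis by (simp add: trapezoid_def)
  qed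
  then show ?thesis using True by (auto intro!: tendsto_eventually eventually_sequentiallyI)
next
  case False
  have "trapezoid n t x = 0" for n
  proof -
    have "real n * (t - x) \<le> 0" using False by (simp add: mult_nonneg_nonpos)
    then show ?thesis by (simp add: trapezoid_def)
  qed
  then show ?thesis using False by simp
qed

text \<open>
  A trapezoid minus the right multiple of one fixed trapezoid has integral zero, hence is the
  derivative of a test function. So \<open>w\<close> integrates every trapezoid like a constant \<open>c\<close>. In the limit
  \<open>w - c\<close> has integral zero over each \<open>(0,t)\<close>, and therefore vanishes almost everywhere.
\<close>

lemma du_Bois_Reymond:
  assumes w: "integrable leb01 w"
    and zero: "\<And>\<phi>. test_function \<phi> \<Longrightarrow> (LINT x|leb01. w x * deriv \<phi> x) = 0"
  shows "\<exists>c. AE x in leb01. w x = c"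
proof -
  have tint: "integrable leb01 (trapezoid n t)" for n t
    by (rule integrable_leb01_bounded[of _ 1])
      (auto intro!: borel_measurable_leb01 borel_measurable_continuous_onI simp: trapezoid_simps abs_of_nonneg)
  have wint: "integrable leb01 (\<lambda>x. h x * trapezoid n t x)" if "integrable leb01 h" for h n t
  proof (rule Bochner_Integration.integrable_bound[OF that])
    show "(\<lambda>x. h x * trapezoid n t x) \<in> borel_measurable leb01" using that tint by measurable
    show "AE x in leb01. norm (h x * trapezoid n t x) \<le> norm (h x)"
      by (auto simp: abs_mult trapezoid_simps abs_of_nonneg intro!: mult_left_le)
  qed
  let ?T = "\<lambda>n t. LINT x|leb01. trapezoid n t x"
  \<comment> \<open>any trapezoid of nonzero integral would do for normalisation; for \<open>n = 8\<close> its support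
      is \<open>[1/8, 7/8]\<close>\<close>
  define I where "I = ?T 8 1"
  define c where "c = (LINT x|leb01. w x * trapezoid 8 1 x) / I"
  have I: "0 < I"
  proof -
    have "(LINT x|leb01. trapezoid 8 1 x * indicator {1/4..<1/2} x) = (LINT x|leb01. indicator {1/4..<1/2} x :: real)"
      by (intro Bochner_Integration.integral_cong) (auto simp: trapezoid_def split: split_indicator)
    also have "\<dots> = (LINT x|lborel. indicator {0<..<1} x * indicator {1/4..<1/2::real} x)"
      by (rule integral_leb01_lborel) simp
    also have "\<dots> = (LINT x|lborel. indicator {1/4..<1/2::real} x)"
      by (intro Bochner_Integration.integral_cong) (auto split: split_indicator)
    also have "\<dots> = 1/4" by simp
    finally have "1/4 = (LINT x|leb01. trapezoid 8 1 x * indicator {1/4..<1/2} x)" by simp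
    also have "\<dots> \<le> I" unfolding I_def
      by (intro integral_mono integrable_mult_indicator_leb01 tint)
        (auto simp: trapezoid_simps split: split_indicator)
    finally show ?thesis by simp
  qed
  have step: "(LINT x|leb01. w x * trapezoid n t x) = c * ?T n t" if nt: "0 < t" "t \<le> 1" "8 \<le> n" for n t
  proof -
    \<comment> \<open>continuous, of integral zero, and supported in \<open>[1/n, 1 - 1/n]\<close> because \<open>n \<ge> 8\<close>\<close>
    let ?g = "\<lambda>x. trapezoid n t x - ?T n t / I * trapezoid 8 1 x"
    have "\<exists>\<phi>. test_function \<phi> \<and> deriv \<phi> = ?g"
    proof (rule test_function_primitive)
      show "continuous_on UNIV ?g" by (intro continuous_intros trapezoid_simps(3))
      have n: "0 < n" "1 / real n \<le> 1 / 8" using nt(3) by (auto simp: field_simps)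
      show "0 < 1 / real n" "1 / real n \<le> 1 - 1 / real n" "1 - 1 / real n < 1"
        using n by auto
      show "?g x = 0" if "x \<le> 1 / real n \<or> 1 - 1 / real n \<le> x" for x
      proof -
        have "trapezoid n t x = 0" by (rule trapezoid_simps(4)) (use that nt n in auto)
        moreover have "x \<le> 1 / 8 \<or> 1 - 1 / 8 \<le> x" using that n(2) by linarith
        then have "trapezoid 8 1 x = 0" by (intro trapezoid_simps(4)) auto
        ultimately show ?thesis by simp
      qed
      show "(LINT x|leb01. ?g x) = 0" using tint I by (simp add: I_def)
    qed
    then have "(LINT x|leb01. w x * ?g x) = 0" using zero by metis
    moreover have "(LINT x|leb01. w x * ?g x) =
       (LINT x|leb01. w x * trapezoid n t x - ?T n t / I * (w x * trapezoid 8 1 x))"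
      by (intro Bochner_Integration.integral_cong) (auto simp: algebra_simps)
    moreover have "\<dots> = (LINT x|leb01. w x * trapezoid n t x) - ?T n t / I * (LINT x|leb01. w x * trapezoid 8 1 x)"
      using wint[OF w] by simp
    ultimately show ?thesis by (simp add: c_def)
  qed
  define h where "h x = w x - c" for x
  have h: "integrable leb01 h"
    unfolding h_def using w by (intro Bochner_Integration.integrable_diff finite_measure.integrable_const finite_measure_leb01)
  have "(LINT x|leb01. h x * indicator {..<t} x) = 0" if t: "0 < t" "t \<le> 1" for t
  proof -
    have "(\<lambda>n. LINT x|leb01. h x * trapezoid n t x) \<longlonglongrightarrow> (LINT x|leb01. h x * indicator {..<t} x)"
    proof (rule integral_dominated_convergence)
      show "integrable leb01 (\<lambda>x. norm (h x))" using h by simp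
      show "(\<lambda>x. h x * indicator {..<t} x) \<in> borel_measurable leb01"
        using integrable_mult_indicator_leb01[OF h, of "{..<t}"] by auto
      show "(\<lambda>x. h x * trapezoid n t x) \<in> borel_measurable leb01" for n using wint[OF h] by auto
      show "AE x in leb01. (\<lambda>n. h x * trapezoid n t x) \<longlonglongrightarrow> h x * indicator {..<t} x"
        by (intro AE_I2 tendsto_mult_left trapezoid_tendsto) (auto simp: space_restrict_space)
      show "AE x in leb01. norm (h x * trapezoid n t x) \<le> norm (h x)" for n
        by (auto simp: abs_mult trapezoid_simps abs_of_nonneg intro!: mult_left_le)
    qed
    moreover have "(LINT x|leb01. h x * trapezoid n t x) = 0" if "8 \<le> n" for n
      unfolding h_def left_diff_distrib using step[OF t that] wint[OF w] tint by simp
    then have "(\<lambda>n. LINT x|leb01. h x * trapezoid n t x) \<longlonglongrightarrow> 0"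
      by (intro tendsto_eventually eventually_sequentiallyI)
    ultimately show ?thesis by (rule LIMSEQ_unique)
  qed
  note zero' = this
  have total: "(LINT x|leb01. h x) = 0"
  proof -
    have "(LINT x|leb01. h x) = (LINT x|leb01. h x * indicator {..<1} x)"
      by (intro Bochner_Integration.integral_cong) (auto simp: space_restrict_space)
    then show ?thesis using zero'[of 1] by simp
  qed
  have "tail h y = 0" for y
  proof -
    consider "y \<le> 0" | "1 \<le> y" | "0 < y" "y \<le> 1" by linarith
    then show ?thesis
    proof cases
      case 3
      have "tail h y = (LINT x|leb01. h x - h x * indicator {..<y} x)"
        unfolding tail_def by (intro Bochner_Integration.integral_cong) (auto split: split_indicator)
      also have "\<dots> = (LINT x|leb01. h x) - (LINT x|leb01. h x * indicator {..<y} x)"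
        by (intro Bochner_Integration.integral_diff integrable_mult_indicator_leb01 h) simp
      finally show ?thesis using total zero'[OF 3] by simp
    qed (use total tail_le_0[of y h] tail_ge_1[of y h] in auto)
  qed
  from tail_eq_0_imp_AE[OF h this] have "AE x in leb01. w x = c"
    by eventually_elim (simp add: h_def)
  then show ?thesis ..
qed

text \<open>
  By the lemma of du Bois-Reymond, \<open>u\<close> differs by a constant from the difference of the distribution
  functions of the two variations of its derivative, and these are bounded.
\<close>

lemma BV_bounded:
  assumes "BV_deriv u Du" shows "\<exists>K. AE x in leb01. \<bar>u x\<bar> \<le> K"
proof -
  have u: "integrable leb01 u" and \<mu>: "finite_signed_measure bor01 Du"
    and eq: "\<And>\<phi>. test_function \<phi> \<Longrightarrow> (LINT x|leb01. u x * deriv \<phi> x) = - signed_integral bor01 Du \<phi>"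
    using assms by (auto simp: BV_deriv_def)
  let ?P = "positive_variation bor01 Du" and ?N = "negative_variation bor01 Du"
  have P: "finite_measure ?P" and N: "finite_measure ?N"
    by (rule finite_measure_positive_variation[OF \<mu>] finite_measure_negative_variation[OF \<mu>])+
  have int: "integrable leb01 (cumulative ?P)" "integrable leb01 (cumulative ?N)"
    by (rule integrable_cumulative[OF P] integrable_cumulative[OF N]; simp)+
  let ?w = "\<lambda>x. u x - cumulative ?P x + cumulative ?N x"
  have "\<exists>c. AE x in leb01. ?w x = c"
  proof (rule du_Bois_Reymond)
    show "integrable leb01 ?w" using u int by simp
    fix \<phi> assume \<phi>: "test_function \<phi>"
    obtain B where B: "\<forall>x\<in>{0..1}. \<bar>deriv \<phi> x\<bar> \<le> B" using test_functionD(6)[OF \<phi>] by blast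
    have i: "integrable leb01 (\<lambda>x. g x * deriv \<phi> x)" if "integrable leb01 g" for g :: "real \<Rightarrow> real"
    proof (rule Bochner_Integration.integrable_bound)
      show "integrable leb01 (\<lambda>x. B * g x)" using that by simp
      show "(\<lambda>x. g x * deriv \<phi> x) \<in> borel_measurable leb01" using that integrable_deriv_test[OF \<phi>] by auto
      have "0 \<le> B" using bspec[OF B, of 0] by auto
      then show "AE x in leb01. norm (g x * deriv \<phi> x) \<le> norm (B * g x)"
        using B by (intro AE_I2) (auto simp: abs_mult mult.commute[of B] space_restrict_space intro!: mult_left_mono)
    qed
    have "(LINT x|leb01. ?w x * deriv \<phi> x) = (LINT x|leb01. u x * deriv \<phi> x - cumulative ?P x * deriv \<phi> x + cumulative ?N x * deriv \<phi> x)"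
      by (intro Bochner_Integration.integral_cong) (auto simp: algebra_simps)
    also have "\<dots> = (LINT x|leb01. u x * deriv \<phi> x) - (LINT x|leb01. cumulative ?P x * deriv \<phi> x) + (LINT x|leb01. cumulative ?N x * deriv \<phi> x)"
      using i[OF u] i[OF int(1)] i[OF int(2)] by simp
    also have "\<dots> = 0"
      using eq[OF \<phi>] integral_cumulative_deriv[OF P _ \<phi>] integral_cumulative_deriv[OF N _ \<phi>]
      by (simp add: signed_integral_def)
    finally show "(LINT x|leb01. ?w x * deriv \<phi> x) = 0" .
  qed
  then obtain c where c: "AE x in leb01. ?w x = c" by blast
  have "AE x in leb01. \<bar>u x\<bar> \<le> \<bar>c\<bar> + measure ?P (space ?P) + measure ?N (space ?N)"
    using c
  proof eventually_elim
    case (elim x)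
    then show ?case
      using cumulative_le[OF P, of x] cumulative_le[OF N, of x] cumulative_nonneg[of ?P x] cumulative_nonneg[of ?N x]
      by linarith
  qed
  then show ?thesis by blast
qed

section \<open>Flux and singular part in the weak equation\<close>

lemma measure_null_measure [simp]: "measure (null_measure M) A = 0"
  by (simp add: measure_def)

lemma finite_measure_null_measure: "finite_measure (null_measure M)"
  by (rule finite_measureI) simp

text \<open>
  \<open>measure (null_measure bor01)\<close> is the zero signed measure.
\<close>

lemma lebesgue_decomp_density:
  assumes h: "integrable leb01 h" "\<And>x. 0 \<le> h x"
  shows "lebesgue_decomp (measure (lebesgue_density h)) h (measure (null_measure bor01))"
  unfolding lebesgue_decomp_def
proof (intro conjI ballI h(1))
  note null = finite_measure_null_measure[of bor01] sets_null_measure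
  show "finite_signed_measure bor01 (measure (null_measure bor01))"
    by (rule finite_signed_measure_measure[OF null])
  show "\<exists>N\<in>sets bor01. emeasure lborel N = 0 \<and>
      emeasure (total_variation bor01 (measure (null_measure bor01))) (space bor01 - N) = 0"
    by (rule bexI[of _ "{}"]) (simp_all add: total_variation_measure[OF null])
  show "measure (lebesgue_density h) A = (LINT x:A|leb01. h x) + measure (null_measure bor01) A"
    if "A \<in> sets bor01" for A
    by (simp add: measure_lebesgue_density[OF h that] set_lebesgue_integral_def mult.commute)
qed

lemma lebesgue_decomp_singular:
  assumes \<rho>: "finite_measure \<rho>" "sets \<rho> = sets bor01"
    and N: "N \<in> sets bor01" "emeasure lborel N = 0" "emeasure \<rho> (space bor01 - N) = 0"
  shows "lebesgue_decomp (measure \<rho>) (\<lambda>_. 0) (measure \<rho>)"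
  unfolding lebesgue_decomp_def total_variation_measure[OF \<rho>]
  using N finite_signed_measure_measure[OF \<rho>] by (auto simp: set_lebesgue_integral_def)

lemma BV_deriv_one: "BV_deriv (\<lambda>_. 1) (measure (null_measure bor01))"
  unfolding BV_deriv_def
proof (intro conjI allI impI)
  note null = finite_measure_null_measure[of bor01] sets_null_measure
  show "integrable leb01 (\<lambda>_. 1 :: real)"
    by (rule finite_measure.integrable_const[OF finite_measure_leb01])
  show "finite_signed_measure bor01 (measure (null_measure bor01))"
    by (rule finite_signed_measure_measure[OF null])
  fix \<phi> assume \<phi>: "test_function \<phi>"
  have "(LINT x|leb01. 1 * deriv \<phi> x) = tail (deriv \<phi>) 0" by (simp add: tail_le_0)
  also have "\<dots> = 0" using tail_deriv[OF \<phi>, of 0] test_functionD(4)[OF \<phi>, of 0] by simp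
  also have "\<dots> = - signed_integral bor01 (measure (null_measure bor01)) \<phi>"
    by (simp add: signed_integral_measure[OF null] integral_null_measure)
  finally show "(LINT x|leb01. 1 * deriv \<phi> x) = - signed_integral bor01 (measure (null_measure bor01)) \<phi>" .
qed

lemma borel_measurable_tail:
  assumes "k \<in> borel_measurable leb01" "AE x in leb01. \<bar>k x\<bar> \<le> K" "0 \<le> K"
  shows "tail k \<in> borel_measurable borel"
  by (rule borel_measurable_continuous_onI[OF continuous_on_tail[OF assms]])

text \<open>
  The identity that defines a bounded variation solution, for \<open>u'\<close> with density \<open>g\<close> and singular part
  \<open>\<sigma>\<close>, and with the right-hand side as a given function \<open>k\<close>: once \<open>u\<close> is known to be bounded, only the
  boundedness of \<open>\<lambda> a f(u)\<close> matters.
\<close>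

definition bv_weak_equation :: "(real \<Rightarrow> real) \<Rightarrow> (real set \<Rightarrow> real) \<Rightarrow> (real \<Rightarrow> real) \<Rightarrow> bool" where
  "bv_weak_equation g \<sigma> k \<longleftrightarrow>
     (\<forall>\<phi> D\<phi> D\<phi>a D\<phi>s.
          BV_deriv \<phi> D\<phi> \<longrightarrow> lebesgue_decomp D\<phi> D\<phi>a D\<phi>s \<longrightarrow>
          absolutely_continuous (total_variation bor01 \<sigma>) (total_variation bor01 D\<phi>s) \<longrightarrow>
          (LINT x|leb01. g x * D\<phi>a x / sqrt (1 + (g x)\<^sup>2))
            + signed_integral bor01 D\<phi>s (polar_density bor01 \<sigma>)
          = (LINT x|leb01. k x * \<phi> x))"

context
  fixes g k :: "real \<Rightarrow> real" and \<sigma> :: "real set \<Rightarrow> real" and K :: real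
  assumes eq: "bv_weak_equation g \<sigma> k"
    and k: "k \<in> borel_measurable leb01" "AE x in leb01. \<bar>k x\<bar> \<le> K" "0 \<le> K"
begin

text \<open>
  Testing with the constant 1. Together with \<open>tail_ge_1\<close> this is the Neumann boundary condition: the
  flux vanishes at both ends.
\<close>

lemma weak_equation_total: "(LINT x|leb01. k x) = 0"
proof -
  note null = finite_measure_null_measure[of bor01] sets_null_measure
  have "lebesgue_decomp (measure (null_measure bor01)) (\<lambda>_. 0) (measure (null_measure bor01))"
    by (intro lebesgue_decomp_singular[OF null, of "{}"]) auto
  moreover have "absolutely_continuous (total_variation bor01 \<sigma>) (total_variation bor01 (measure (null_measure bor01)))"
    by (auto simp: total_variation_measure[OF null] absolutely_continuous_def null_sets_def)
  ultimately show ?thesis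
    using eq BV_deriv_one unfolding bv_weak_equation_def
    by (fastforce simp: signed_integral_measure[OF null] integral_null_measure)
qed

text \<open>
  Testing with the distribution function of Lebesgue measure restricted to a Borel set \<open>A\<close>, and
  applying Fubini on the right, shows that both functions have the same integral over \<open>A\<close>.
\<close>

lemma weak_equation_density:
  assumes g: "integrable leb01 g"
  shows "AE x in leb01. g x / sqrt (1 + (g x)\<^sup>2) = tail k x"
proof (rule AE_leb01_eqI)
  note null = finite_measure_null_measure[of bor01] sets_null_measure
  have gm [measurable]: "g \<in> borel_measurable leb01" using g by auto
  have tm: "tail k \<in> borel_measurable borel" by (rule borel_measurable_tail[OF k])
  have kint: "integrable leb01 k" by (rule integrable_leb01_bounded[OF k(1,2)])
  show "integrable leb01 (\<lambda>x. g x / sqrt (1 + (g x)\<^sup>2))"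
  proof (rule integrable_leb01_bounded[of _ 1])
    have "\<bar>g x\<bar> \<le> sqrt (1 + (g x)\<^sup>2)" for x by (rule real_le_rsqrt) simp
    then have "\<bar>g x / sqrt (1 + (g x)\<^sup>2)\<bar> \<le> 1" for x
      by (auto simp: abs_divide intro!: divide_le_eq_1_pos[THEN iffD2] add_pos_nonneg)
    then show "AE x in leb01. \<bar>g x / sqrt (1 + (g x)\<^sup>2)\<bar> \<le> 1" by simp
  qed measurable
  show "integrable leb01 (tail k)"
  proof (rule integrable_leb01_bounded[of _ K])
    show "AE x in leb01. \<bar>tail k x\<bar> \<le> K"
    proof (intro AE_I2)
      fix x :: real assume "x \<in> space leb01"
      then have "\<bar>tail k x - tail k 1\<bar> \<le> K * 1"
        using k(3) by (intro order_trans[OF tail_lipschitz[OF k]] mult_left_mono) (auto simp: space_restrict_space)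
      then show "\<bar>tail k x\<bar> \<le> K" by (simp add: tail_ge_1)
    qed
  qed (rule borel_measurable_leb01[OF tm])
  fix A assume A: "A \<in> sets bor01"
  let ?h = "indicator A :: real \<Rightarrow> real"
  have h: "integrable leb01 ?h" "\<And>x. 0 \<le> ?h x"
    using A integrable_mult_indicator_leb01[of "\<lambda>_. 1" A] finite_measure.integrable_const[OF finite_measure_leb01, of "1::real"]
    by (auto simp: sets_bor01_iff)
  have \<rho>: "finite_measure (lebesgue_density ?h)" by (rule finite_measure_lebesgue_density[OF h])
  have "absolutely_continuous (total_variation bor01 \<sigma>) (total_variation bor01 (measure (null_measure bor01)))"
    by (auto simp: total_variation_measure[OF null] absolutely_continuous_def null_sets_def)
  with eq BV_deriv_cumulative[OF \<rho> sets_lebesgue_density] lebesgue_decomp_density[OF h]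
  have "(LINT x|leb01. g x * ?h x / sqrt (1 + (g x)\<^sup>2))
      + signed_integral bor01 (measure (null_measure bor01)) (polar_density bor01 \<sigma>)
      = (LINT x|leb01. k x * cumulative (lebesgue_density ?h) x)"
    unfolding bv_weak_equation_def by blast
  also have "\<dots> = (LINT y|lebesgue_density ?h. tail k y)"
    by (rule integral_cumulative[OF \<rho> sets_lebesgue_density kint])
  also have "\<dots> = (LINT x|leb01. ?h x * tail k x)"
    by (rule integral_lebesgue_density[OF h measurable_restrict_space1[OF tm]])
  finally show "(LINT x|leb01. g x / sqrt (1 + (g x)\<^sup>2) * ?h x) = (LINT x|leb01. tail k x * ?h x)"
    by (simp add: signed_integral_measure[OF null] integral_null_measure mult.commute)
qed

text \<open>
  Testing with the distribution function of \<open>|\<sigma>|\<close> restricted to \<open>A\<close>, which is admissible and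
  purely singular. So the polar density of \<open>\<sigma>\<close> is the flux.
\<close>

lemma weak_equation_singular:
  assumes \<sigma>: "finite_signed_measure bor01 \<sigma>"
    and N: "N \<in> sets bor01" "emeasure lborel N = 0"
      "emeasure (total_variation bor01 \<sigma>) (space bor01 - N) = 0"
    and A: "A \<in> sets bor01"
  shows "\<sigma> A = (LINT y|total_variation bor01 \<sigma>. indicator A y * tail k y)"
proof -
  let ?T = "total_variation bor01 \<sigma>" and ?h = "indicator A :: real \<Rightarrow> real"
  interpret T: finite_measure ?T by (rule finite_measure_total_variation[OF \<sigma>])
  have kint: "integrable leb01 k" by (rule integrable_leb01_bounded[OF k(1,2)])
  have [measurable]: "tail k \<in> borel_measurable ?T"
    using measurable_restrict_space1[OF borel_measurable_tail[OF k], of "{0<..<1}"]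
    by (simp cong: measurable_cong_sets)
  have [measurable]: "?h \<in> borel_measurable ?T" using A by simp
  define \<rho> where "\<rho> = density ?T (\<lambda>x. ennreal (?h x))"
  have sets: "sets \<rho> = sets bor01" by (simp add: \<rho>_def)
  have le: "emeasure \<rho> B \<le> emeasure ?T B" if "B \<in> sets bor01" for B
  proof -
    have "emeasure \<rho> B = (\<integral>\<^sup>+x. ennreal (?h x) * indicator B x \<partial>?T)"
      unfolding \<rho>_def using that by (intro emeasure_density) auto
    also have "\<dots> \<le> (\<integral>\<^sup>+x. indicator B x \<partial>?T)"
      by (intro nn_integral_mono) (auto split: split_indicator)
    finally show ?thesis using that by simp
  qed
  have "emeasure \<rho> (space \<rho>) \<le> emeasure ?T (space bor01)"
    using le[OF sets.top] unfolding sets_eq_imp_space_eq[OF sets] .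
  then have \<rho>: "finite_measure \<rho>"
    by (intro finite_measureI) (metis T.emeasure_finite infinity_ennreal_def top_unique)
  have ac: "absolutely_continuous ?T (total_variation bor01 (measure \<rho>))"
    unfolding total_variation_measure[OF \<rho> sets] absolutely_continuous_def
    using le by (auto simp: null_sets_def sets) (metis le_zero_eq)
  have "emeasure \<rho> (space bor01 - N) = 0"
    using le[OF sets.Diff[OF sets.top N(1)]] unfolding N(3) by simp
  with eq BV_deriv_cumulative[OF \<rho> sets] lebesgue_decomp_singular[OF \<rho> sets N(1,2)] ac
  have "(LINT x|leb01. g x * 0 / sqrt (1 + (g x)\<^sup>2))
      + signed_integral bor01 (measure \<rho>) (polar_density bor01 \<sigma>)
      = (LINT x|leb01. k x * cumulative \<rho> x)"
    unfolding bv_weak_equation_def by blast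
  then have "(LINT x|\<rho>. polar_density bor01 \<sigma> x) = (LINT x|\<rho>. tail k x)"
    by (simp add: signed_integral_measure[OF \<rho> sets] integral_cumulative[OF \<rho> sets kint])
  moreover have "(LINT x|\<rho>. polar_density bor01 \<sigma> x) = (LINT x|?T. ?h x *\<^sub>R polar_density bor01 \<sigma> x)"
    unfolding \<rho>_def using polar_density_integral(1)[OF \<sigma> A] by (intro integral_density) auto
  moreover have "(LINT x|\<rho>. tail k x) = (LINT x|?T. ?h x *\<^sub>R tail k x)"
    unfolding \<rho>_def by (intro integral_density) auto
  ultimately show ?thesis using polar_density_integral(2)[OF \<sigma> A] by (simp add: mult.commute)
qed

end

text \<open>
  Summing the hypothesis over a partition gives \<open>|\<mu>| \<le> \<theta> |\<mu>|\<close> for the total mass. For a polar density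
  of modulus 1 this is the fact that it cannot be bounded by \<open>\<theta> < 1\<close> on a set of positive mass.
\<close>

lemma finite_signed_measure_eq_0:
  assumes \<mu>: "finite_signed_measure M \<mu>" and \<theta>: "0 \<le> \<theta>" "\<theta> < (1::real)"
    and le: "\<And>A. A \<in> sets M \<Longrightarrow> \<bar>\<mu> A\<bar> \<le> \<theta> * measure (total_variation M \<mu>) A"
    and A: "A \<in> sets M"
  shows "\<mu> A = 0"
proof -
  let ?T = "total_variation M \<mu>"
  interpret T: finite_measure ?T by (rule finite_measure_total_variation[OF \<mu>])
  have "variation M \<mu> (space M) \<le> ennreal (\<theta> * measure ?T (space M))"
  proof (rule variation_least)
    fix P assume P: "finite P" "P \<subseteq> sets M" "partition_on (space M) P"
    have "(\<Sum>B\<in>P. ennreal \<bar>\<mu> B\<bar>) = ennreal (\<Sum>B\<in>P. \<bar>\<mu> B\<bar>)" by simp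
    also have "\<dots> \<le> ennreal (\<Sum>B\<in>P. \<theta> * measure ?T B)"
      using P(2) le by (intro ennreal_leI sum_mono) auto
    also have "(\<Sum>B\<in>P. \<theta> * measure ?T B) = \<theta> * measure ?T (\<Union>B\<in>P. B)"
    proof -
      have "measure ?T (\<Union>B\<in>P. B) = (\<Sum>B\<in>P. measure ?T B)"
      proof (rule T.finite_measure_finite_Union[OF P(1)])
        show "disjoint_family_on (\<lambda>B. B) P"
          unfolding disjoint_family_on_def using disjointD[OF partition_onD2[OF P(3)]] by blast
      qed (use P(2) in auto)
      then show ?thesis by (simp add: sum_distrib_left)
    qed
    finally show "(\<Sum>B\<in>P. ennreal \<bar>\<mu> B\<bar>) \<le> ennreal (\<theta> * measure ?T (space M))"
      using P(3) by (simp add: partition_on_def)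
  qed
  then have "ennreal (measure ?T (space M)) \<le> ennreal (\<theta> * measure ?T (space M))"
    using emeasure_total_variation[OF \<mu> sets.top] by (simp add: T.emeasure_eq_measure)
  then have "measure ?T (space M) \<le> \<theta> * measure ?T (space M)"
    using \<theta>(1) by simp
  then have "(1 - \<theta>) * measure ?T (space M) \<le> 0" by (simp add: algebra_simps)
  then have "measure ?T (space M) = 0"
    using \<theta>(2) by (smt (verit) measure_nonneg mult_pos_pos)
  then have "measure ?T A = 0"
    using T.bounded_measure[of A] by (simp add: measure_le_0_iff)
  then show ?thesis using le[OF A] by simp
qed

lemma curvature_slope:
  fixes g F :: real
  assumes "F = g / sqrt (1 + g\<^sup>2)"
  shows "1 - F\<^sup>2 = 1 / (1 + g\<^sup>2)" "\<bar>F\<bar> < 1" "g = F / sqrt (1 - F\<^sup>2)"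
proof -
  have p: "0 < 1 + g\<^sup>2" by (simp add: add_pos_nonneg)
  show 1: "1 - F\<^sup>2 = 1 / (1 + g\<^sup>2)"
    using p by (simp add: assms power_divide field_simps)
  then have "F\<^sup>2 < 1" using p by (smt (verit) divide_pos_pos)
  then show "\<bar>F\<bar> < 1" by (simp add: abs_square_less_1)
  show "g = F / sqrt (1 - F\<^sup>2)"
    unfolding 1 using p by (simp add: assms real_sqrt_divide)
qed

lemma slope_curvature:
  fixes F :: real
  assumes "\<bar>F\<bar> < 1"
  shows "F / sqrt (1 - F\<^sup>2) / sqrt (1 + (F / sqrt (1 - F\<^sup>2))\<^sup>2) = F"
proof -
  have p: "0 < 1 - F\<^sup>2" using assms by (simp add: abs_square_less_1)
  have "1 + (F / sqrt (1 - F\<^sup>2))\<^sup>2 = 1 / (1 - F\<^sup>2)"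
    using p by (simp add: power_divide field_simps)
  then show ?thesis using p by (simp add: real_sqrt_divide)
qed

lemma slope_has_derivative:
  fixes s :: real
  assumes "\<bar>s\<bar> < 1"
  shows "((\<lambda>s. s / sqrt (1 - s\<^sup>2)) has_real_derivative 1 / ((1 - s\<^sup>2) * sqrt (1 - s\<^sup>2))) (at s)"
proof -
  have p: "0 < 1 - s\<^sup>2" using assms by (simp add: abs_square_less_1)
  define r where "r = sqrt (1 - s\<^sup>2)"
  have r: "0 < r" "r * r = 1 - s\<^sup>2" using p by (auto simp: r_def)
  have "((\<lambda>s. s / sqrt (1 - s\<^sup>2)) has_real_derivative
      (1 * r - s * ((- (2 * s)) * (inverse r / 2))) / (r * r)) (at s)"
    unfolding r_def using p r(1)
    by (auto intro!: derivative_eq_intros simp: r_def[symmetric])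
  also have "(1 * r - s * ((- (2 * s)) * (inverse r / 2))) / (r * r) = (r * r + s\<^sup>2) / (r * r * r)"
    using r(1) by (simp add: field_simps power2_eq_square)
  also have "\<dots> = 1 / ((1 - s\<^sup>2) * r)" using r(2) by simp
  finally show ?thesis by (simp add: r_def)
qed

text \<open>
  With flux \<open>F\<close> and slope \<open>g\<close> one has \<open>1 / (1 + g\<^sup>2) = (1 + F) (1 - F) \<le> 2 (1 + F)\<close>. So where \<open>1 + F\<close>
  is at most \<open>c A\<close>, the slope \<open>|g|\<close> plus 1 is at least of the order of \<open>A\<close> to the power \<open>-1/2\<close>.
\<close>

lemma powr_le_slope:
  fixes A F g c :: real
  assumes F: "F = g / sqrt (1 + g\<^sup>2)" and c: "0 < c" and le: "1 + F \<le> c * A"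
  shows "A powr (- 1/2) \<le> 2 * sqrt c * (1 + \<bar>g\<bar>)"
proof -
  have p: "0 < 1 + g\<^sup>2" by (simp add: add_pos_nonneg)
  note s = curvature_slope[OF F]
  have "1 / (1 + g\<^sup>2) = (1 + F) * (1 - F)" unfolding s(1)[symmetric] by (simp add: power2_eq_square algebra_simps)
  also have "\<dots> \<le> (1 + F) * 2" using s(2) by (intro mult_left_mono) auto
  also have "\<dots> \<le> 2 * (c * A)" using le by simp
  finally have 1: "1 / (1 + g\<^sup>2) \<le> 2 * c * A" by simp
  then have "0 < 2 * c * A" using p by (smt (verit) divide_pos_pos)
  then have A: "0 < A" using c by (simp add: zero_less_mult_iff)
  have "A powr (- 1/2) = sqrt (1 / A)"
    using A by (simp add: powr_minus powr_half_sqrt real_sqrt_divide inverse_eq_divide)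
  also have "\<dots> \<le> sqrt ((2 * sqrt c * (1 + \<bar>g\<bar>))\<^sup>2)"
  proof (rule real_sqrt_le_mono)
    have "1 \<le> (2 * c * A) * (1 + g\<^sup>2)" using 1 p by (simp add: pos_divide_le_eq)
    then have "1 / A \<le> 2 * c * (1 + g\<^sup>2)" using A by (simp add: pos_divide_le_eq mult_ac)
    also have "\<dots> \<le> 4 * c * (1 + \<bar>g\<bar>)\<^sup>2"
      using c by (simp add: power2_sum algebra_simps)
    also have "\<dots> = (2 * sqrt c * (1 + \<bar>g\<bar>))\<^sup>2" using c by (simp add: power_mult_distrib)
    finally show "1 / A \<le> (2 * sqrt c * (1 + \<bar>g\<bar>))\<^sup>2" .
  qed
  also have "\<dots> = 2 * sqrt c * (1 + \<bar>g\<bar>)" using c by simp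
  finally show ?thesis .
qed

lemma interval_integral_eq_tail:
  assumes a: "integrable leb01 a" and s: "0 \<le> s" "s \<le> 1" "0 \<le> t" "t \<le> 1"
  shows "(LINT x=ereal s..ereal t|lebesgue. a x) = tail a s - tail a t"
proof -
  have le: "(LINT x:{s<..<t}|lebesgue. a x) = tail a s - tail a t"
    if st: "0 \<le> s" "s \<le> t" "t \<le> 1" for s t
  proof -
    have "(LINT x:{s<..<t}|lebesgue. a x) = (LINT x|lebesgue. indicator {0<..<1} x *\<^sub>R (a x * indicator {s<..<t} x))"
      unfolding set_lebesgue_integral_def using st
      by (intro Bochner_Integration.integral_cong) (auto split: split_indicator)
    also have "\<dots> = (LINT x|leb01. a x * indicator {s<..<t} x)"
      by (rule integral_restrict_space[symmetric]) simp
    also have "\<dots> = (LINT x|leb01. a x * indicator {s..<t} x)"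
    proof (rule integral_cong_AE)
      show "AE x in leb01. a x * indicator {s<..<t} x = a x * indicator {s..<t} x"
        by (rule AE_leb01I) (use AE_lborel_singleton[of s] in eventually_elim, auto split: split_indicator)
    qed (auto intro!: borel_measurable_integrable integrable_mult_indicator_leb01 a)
    finally show ?thesis by (simp add: tail_diff[OF a st(2)])
  qed
  show ?thesis
    using le[of s t] le[of t s] s by (auto simp: interval_lebesgue_integral_def)
qed

section \<open>Regularity\<close>

lemma nn_integral_lebesgue_on_subset_finite:
  assumes S: "S \<in> sets borel" "S \<subseteq> {0<..<1}"
    and g: "integrable leb01 g" and h: "AE x in leb01. h x \<le> g x" "\<And>x. 0 \<le> g x"
  shows "(\<integral>\<^sup>+x. ennreal (h x) \<partial>lebesgue_on S) < \<infinity>"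
proof -
  have "AE x in lebesgue. x \<in> {0<..<1} \<longrightarrow> h x \<le> g x"
    using h(1) by (subst (asm) AE_restrict_space_iff) auto
  then have ae: "AE x in lebesgue. ennreal (h x) * indicator S x \<le> ennreal (g x) * indicator {0<..<1} x"
    by eventually_elim (use S(2) in \<open>auto split: split_indicator intro!: ennreal_leI\<close>)
  have "(\<integral>\<^sup>+x. ennreal (h x) \<partial>lebesgue_on S) = (\<integral>\<^sup>+x. ennreal (h x) * indicator S x \<partial>lebesgue)"
    by (rule nn_integral_restrict_space) (use S in simp)
  also have "\<dots> \<le> (\<integral>\<^sup>+x. ennreal (g x) * indicator {0<..<1} x \<partial>lebesgue)"
    by (rule nn_integral_mono_AE[OF ae])
  also have "\<dots> = (\<integral>\<^sup>+x. ennreal (g x) \<partial>leb01)"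
    by (rule nn_integral_restrict_space[symmetric]) simp
  also have "\<dots> < \<infinity>"
    using g h(2) by (simp add: nn_integral_eq_integral)
  finally show ?thesis .
qed

lemma tail_mono_nonneg:
  assumes k: "integrable leb01 k" and s: "s \<le> t" and nn: "AE x in leb01. s \<le> x \<and> x < t \<longrightarrow> 0 \<le> k x"
  shows "tail k t \<le> tail k s"
proof -
  have "0 \<le> (LINT x|leb01. k x * indicator {s..<t} x)"
    by (rule integral_nonneg_AE) (use nn in eventually_elim, auto split: split_indicator)
  then show ?thesis using tail_diff[OF k s] by simp
qed

lemma tail_mono_nonpos:
  assumes k: "integrable leb01 k" and s: "s \<le> t" and np: "AE x in leb01. s \<le> x \<and> x < t \<longrightarrow> k x \<le> 0"
  shows "tail k s \<le> tail k t"
proof -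
  have "(LINT x|leb01. k x * indicator {s..<t} x) \<le> (LINT x|leb01. 0)"
  proof (rule integral_mono_AE)
    show "AE x in leb01. k x * indicator {s..<t} x \<le> 0"
      using np by eventually_elim (auto split: split_indicator)
  qed (auto intro!: integrable_mult_indicator_leb01 k)
  then show ?thesis using tail_diff[OF k s] by simp
qed

lemma tail_linear:
  assumes "integrable leb01 k" "integrable leb01 a"
  shows "tail (\<lambda>x. k x - c * a x) y = tail k y - c * tail a y"
proof -
  have "tail (\<lambda>x. k x - c * a x) y = (LINT x|leb01. k x * indicator {y..} x - c * (a x * indicator {y..} x))"
    unfolding tail_def by (intro Bochner_Integration.integral_cong) (auto simp: algebra_simps)
  also have "\<dots> = tail k y - c * tail a y"
    unfolding tail_def
    by (subst Bochner_Integration.integral_diff) (auto intro!: integrable_mult_right integrable_mult_indicator_leb01 assms)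
  finally show ?thesis .
qed

lemma Linfty01_bound:
  assumes "Linfty01 a" shows "\<exists>C\<ge>0. AE x in leb01. \<bar>a x\<bar> \<le> C"
proof -
  have "esssup leb01 (\<lambda>x. ereal \<bar>a x\<bar>) < \<infinity>" using assms by (simp add: Linfty01_def)
  then obtain C where C: "esssup leb01 (\<lambda>x. ereal \<bar>a x\<bar>) \<le> ereal C"
    by (cases "esssup leb01 (\<lambda>x. ereal \<bar>a x\<bar>)") auto
  have "AE x in leb01. \<bar>a x\<bar> \<le> \<bar>C\<bar>"
    using esssup_AE[of "\<lambda>x. ereal \<bar>a x\<bar>" leb01]
  proof eventually_elim
    case (elim x)
    then have "ereal \<bar>a x\<bar> \<le> ereal C" using C by (rule order_trans)
    then show ?case by simp
  qed
  then show ?thesis by (intro exI[of _ "\<bar>C\<bar>"]) simp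
qed

lemma positive_function_nonneg:
  assumes "positive_function u" shows "AE x in leb01. 0 \<le> u x"
proof -
  have "esssup leb01 (\<lambda>x. - ereal (u x)) \<le> 0"
    using assms by (simp add: positive_function_def essinf_def)
  from esssup_AE[of "\<lambda>x. - ereal (u x)" leb01] show ?thesis
  proof eventually_elim
    case (elim x)
    then have "- ereal (u x) \<le> 0" using \<open>esssup leb01 (\<lambda>x. - ereal (u x)) \<le> 0\<close> by (rule order_trans)
    then show ?case by simp
  qed
qed

lemma AE_lebesgue_on_leb01:
  assumes "AE x in lebesgue_on {s<..<t}. P x"
  shows "AE x in leb01. s < x \<and> x < t \<longrightarrow> P x"
proof -
  have "AE x in lebesgue. x \<in> {s<..<t} \<longrightarrow> P x"
    using assms by (subst (asm) AE_restrict_space_iff) auto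
  then have "AE x in lebesgue. x \<in> {0<..<1} \<longrightarrow> s < x \<and> x < t \<longrightarrow> P x"
    by eventually_elim simp
  then show ?thesis by (subst AE_restrict_space_iff) simp_all
qed

text \<open>
  The slope is \<open>G(F)\<close> for the flux \<open>F\<close> and \<open>G s = s / sqrt (1 - s\<^sup>2)\<close>. As long as \<open>|F|\<close> stays away
  from 1, this composition is bounded and Lipschitz, and the chain rule applies to it.
\<close>

lemma slope_of_flux:
  assumes k: "k \<in> borel_measurable leb01" "AE x in leb01. \<bar>k x\<bar> \<le> K" "0 \<le> K"
    and \<theta>: "\<And>y. \<bar>tail k y\<bar> \<le> \<theta>" "\<theta> < 1"
  defines "v \<equiv> \<lambda>x. tail k x / sqrt (1 - (tail k x)\<^sup>2)"
  shows "\<exists>w. weak_deriv v w" "continuous_on UNIV v" "integrable leb01 v"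
    "weak_deriv (\<lambda>x. v x / sqrt (1 + (v x)\<^sup>2)) (\<lambda>x. - k x)"
proof -
  let ?F = "tail k"
  let ?G = "\<lambda>s :: real. s / sqrt (1 - s\<^sup>2)" and ?G' = "\<lambda>s :: real. 1 / ((1 - s\<^sup>2) * sqrt (1 - s\<^sup>2))"
  let ?w = "\<lambda>x. ?G' (?F x) * k x"
  have F1: "\<bar>?F y\<bar> < 1" for y using \<theta>(1)[of y] \<theta>(2) by simp
  have \<theta>0: "0 \<le> \<theta>" using \<theta>(1)[of 0] by simp
  have q: "0 < 1 - \<theta>\<^sup>2" using \<theta>0 \<theta>(2) by (simp add: abs_square_less_1)
  have p: "1 - \<theta>\<^sup>2 \<le> 1 - (?F y)\<^sup>2" for y
    using power_mono[OF \<theta>(1)[of y] abs_ge_zero, of 2] by simp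
  have p0: "0 < 1 - (?F y)\<^sup>2" for y using p[of y] q by linarith
  have kint: "integrable leb01 k" by (rule integrable_leb01_bounded[OF k(1,2)])
  have Fm [measurable]: "?F \<in> borel_measurable leb01" by (rule borel_measurable_leb01[OF borel_measurable_tail[OF k]])
  have [measurable]: "k \<in> borel_measurable leb01" by (rule k(1))
  have wint: "integrable leb01 ?w"
  proof (rule integrable_leb01_bounded)
    show "AE x in leb01. \<bar>?w x\<bar> \<le> 1 / ((1 - \<theta>\<^sup>2) * sqrt (1 - \<theta>\<^sup>2)) * K"
      using k(2)
    proof eventually_elim
      case (elim x)
      have "?G' (?F x) \<le> 1 / ((1 - \<theta>\<^sup>2) * sqrt (1 - \<theta>\<^sup>2))"
        using p[of x] q by (intro divide_left_mono mult_mono mult_pos_pos) auto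
      moreover have "0 \<le> ?G' (?F x)" using p0[of x] by simp
      ultimately show ?case using elim k(3) q
        unfolding abs_mult by (intro mult_mono) auto
    qed
  qed measurable
  have chain: "?G (?F y) = ?G 0 + tail ?w y" for y
  proof (rule tail_chain_rule[OF k, where S = "{-1<..<1}"])
    show "?F y \<in> {-1<..<1}" for y using F1[of y] by auto
    show "(?G has_real_derivative ?G' s) (at s)" if "s \<in> {-1<..<1}" for s
      by (rule slope_has_derivative) (use that in auto)
    show "continuous_on {-1<..<1} ?G'"
    proof (intro continuous_intros ballI)
      fix s :: real assume "s \<in> {-1<..<1}"
      then have "s\<^sup>2 < 1" by (simp add: abs_square_less_1 abs_less_iff)
      then show "(1 - s\<^sup>2) * sqrt (1 - s\<^sup>2) \<noteq> 0" by simp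
    qed
  qed (use wint in simp_all)
  have v: "v = tail ?w" unfolding v_def using chain by (simp add: fun_eq_iff)
  show "\<exists>w. weak_deriv v w" unfolding v using weak_deriv_tail[OF wint] by blast
  then show "integrable leb01 v" by (auto simp: weak_deriv_def)
  show "continuous_on UNIV v"
    unfolding v_def using p0 by (intro continuous_intros continuous_on_tail[OF k]) (metis less_irrefl real_sqrt_gt_zero)
  have "(\<lambda>x. v x / sqrt (1 + (v x)\<^sup>2)) = ?F"
    unfolding v_def by (rule ext, rule slope_curvature, rule F1)
  then show "weak_deriv (\<lambda>x. v x / sqrt (1 + (v x)\<^sup>2)) (\<lambda>x. - k x)"
    using weak_deriv_tail[OF kint] by simp
qed

theorem theorem7p2:
  fixes a f u :: "real \<Rightarrow> real" and z lam :: real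
  assumes "Linfty01 a"
    and "(LINT x|leb01. a x) < 0"
    and "0 < z" and "z < 1"
    and "AE x in lebesgue_on {0<..<z}. a x > 0"
    and "AE x in lebesgue_on {z<..<1}. a x < 0"
    and "(\<integral>\<^sup>+x. ennreal ((LINT t=ereal x..ereal z|lebesgue. a t) powr (- 1/2)) \<partial>lebesgue_on {0<..<z}) = \<infinity> \<or>
         (\<integral>\<^sup>+x. ennreal ((LINT t=ereal x..ereal z|lebesgue. a t) powr (- 1/2)) \<partial>lebesgue_on {z<..<1}) = \<infinity>"
    and "continuous_on UNIV f"
    and "\<And>s. s \<ge> 0 \<Longrightarrow> f s \<ge> 0"
    and "lam > 0"
    and "bv_solution a f lam u"
    and "positive_function u"
  shows "regular_solution a f lam u"
proof -
  define k where "k x = lam * a x * f (u x)" for x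
  obtain Du g \<sigma> where Du: "BV_deriv u Du" and dec: "lebesgue_decomp Du g \<sigma>" and eq: "bv_weak_equation g \<sigma> k"
    using assms(11) unfolding bv_solution_def bv_weak_equation_def k_def by blast
  have uint: "integrable leb01 u" using Du by (simp add: BV_deriv_def)
  have gint: "integrable leb01 g" and \<sigma>: "finite_signed_measure bor01 \<sigma>"
    and Du_eq: "\<And>A. A \<in> sets bor01 \<Longrightarrow> Du A = (LINT x:A|leb01. g x) + \<sigma> A"
    using dec by (auto simp: lebesgue_decomp_def)
  obtain N where N: "N \<in> sets bor01" "emeasure lborel N = 0"
    "emeasure (total_variation bor01 \<sigma>) (space bor01 - N) = 0"
    using dec by (auto simp: lebesgue_decomp_def)

  have am [measurable]: "a \<in> borel_measurable leb01" using assms(1) by (simp add: Linfty01_def)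
  have [measurable]: "u \<in> borel_measurable leb01" using uint by auto
  have [measurable]: "f \<in> borel_measurable borel" by (rule borel_measurable_continuous_onI[OF assms(8)])
  obtain C where C: "0 \<le> C" "AE x in leb01. \<bar>a x\<bar> \<le> C" using Linfty01_bound[OF assms(1)] by blast
  have aint: "integrable leb01 a" by (rule integrable_leb01_bounded[OF am C(2)])
  obtain R where R: "AE x in leb01. \<bar>u x\<bar> \<le> R" using BV_bounded[OF Du] by blast
  have "bounded (f ` {-R..R})"
    by (intro compact_imp_bounded compact_continuous_image continuous_on_subset[OF assms(8)]) auto
  then obtain M where M: "0 < M" "\<And>s. \<bar>s\<bar> \<le> R \<Longrightarrow> \<bar>f s\<bar> \<le> M"
    unfolding bounded_pos by (auto simp: abs_le_iff)
  have fu: "AE x in leb01. 0 \<le> f (u x) \<and> f (u x) \<le> M"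
    using R positive_function_nonneg[OF assms(12)]
    by eventually_elim (use M(2) assms(9) in \<open>auto simp: abs_le_iff\<close>)

  have km: "k \<in> borel_measurable leb01" unfolding k_def[abs_def] by measurable
  have kb: "AE x in leb01. \<bar>k x\<bar> \<le> lam * C * M"
    using fu C(2)
  proof eventually_elim
    case (elim x)
    then show ?case unfolding k_def abs_mult using assms(10) C(1) by (intro mult_mono) auto
  qed
  have K0: "0 \<le> lam * C * M" using assms(10) C(1) M(1) by simp
  note k = km kb K0
  have kint: "integrable leb01 k" by (rule integrable_leb01_bounded[OF km kb])
  \<comment> \<open>with this constant \<open>|k| \<le> c |a|\<close>, and the signs of \<open>k\<close> and \<open>a\<close> are never opposite\<close>
  define c where "c = lam * M"
  have c: "0 < c" using assms(10) M(1) by (simp add: c_def)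
  have nez: "AE x in leb01. x \<noteq> z"
    by (rule AE_leb01I) (use AE_lborel_singleton[of z] in eventually_elim, simp)
  have sign: "AE x in leb01. (x < z \<longrightarrow> 0 \<le> k x \<and> k x \<le> c * a x) \<and> (z < x \<longrightarrow> k x \<le> 0 \<and> c * a x \<le> k x)"
    using fu AE_lebesgue_on_leb01[OF assms(5)] AE_lebesgue_on_leb01[OF assms(6)] AE_space[of leb01]
  proof eventually_elim
    case (elim x)
    have e: "k x = lam * f (u x) * a x" by (simp add: k_def)
    have l: "lam * f (u x) \<le> c" "0 \<le> lam * f (u x)" using elim assms(10) by (auto simp: c_def)
    show ?case
    proof (intro conjI impI)
      assume "x < z"
      then have "0 < a x" using elim by (simp add: space_restrict_space)
      then show "0 \<le> k x" "k x \<le> c * a x" unfolding e using l by (auto intro: mult_right_mono)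
    next
      assume "z < x"
      then have "a x < 0" using elim by (simp add: space_restrict_space)
      then show "k x \<le> 0" "c * a x \<le> k x" unfolding e using l by (auto intro: mult_right_mono_neg mult_nonneg_nonpos)
    qed
  qed

  let ?F = "tail k"
  have F0: "?F y = 0" if "y \<le> 0" for y using weak_equation_total[OF eq k] that by (simp add: tail_le_0)
  have F1: "?F y = 0" if "1 \<le> y" for y using that by (rule tail_ge_1)
  have decr: "?F t \<le> ?F s" if "s \<le> t" "t \<le> z" for s t
    by (rule tail_mono_nonneg[OF kint that(1)]) (use sign in eventually_elim, use that in auto)
  have incr: "?F s \<le> ?F t" if "s \<le> t" "z \<le> s" for s t
    by (rule tail_mono_nonpos[OF kint that(1)]) (use sign nez in eventually_elim, use that in auto)
  \<comment> \<open>the flux decreases from 0 to its minimum at \<open>z\<close> and then increases back to 0\<close>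
  have Fz: "?F z \<le> ?F y" for y using decr[of y z] incr[of z y] by linarith
  have F_nonpos: "?F y \<le> 0" for y
    using decr[of 0 y] decr[of y y] incr[of y 1] F0[of y] F0[of 0] F1[of y] F1[of 1] by linarith
  \<comment> \<open>since \<open>k - c a\<close> changes sign at \<open>z\<close> from nonpositive to nonnegative\<close>
  have growth: "?F y - ?F z \<le> c * (tail a y - tail a z)" for y
  proof -
    have int: "integrable leb01 (\<lambda>x. k x - c * a x)" using kint aint by simp
    have "tail (\<lambda>x. k x - c * a x) y \<le> tail (\<lambda>x. k x - c * a x) z"
    proof (cases "y \<le> z")
      case True
      show ?thesis
        by (rule tail_mono_nonpos[OF int True]) (use sign in eventually_elim, auto)
    next
      case False
      then have "z \<le> y" by simp
      show ?thesis
        by (rule tail_mono_nonneg[OF int \<open>z \<le> y\<close>]) (use sign nez in eventually_elim, auto)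
    qed
    then show ?thesis by (simp add: tail_linear[OF kint aint] algebra_simps)
  qed

  have gF: "AE x in leb01. g x / sqrt (1 + (g x)\<^sup>2) = ?F x"
    by (rule weak_equation_density[OF eq k gint])

  \<comment> \<open>if the flux reached -1 at \<open>z\<close>, a multiple of \<open>1 + |g|\<close> would dominate the function of which
      one of the two integrals is infinite, although \<open>g\<close> is integrable\<close>
  have Fz_gt: "-1 < ?F z"
  proof (rule ccontr)
    assume "\<not> -1 < ?F z"
    have bound: "AE x in leb01. (LINT t=ereal x..ereal z|lebesgue. a t) powr (- 1/2) \<le> 2 * sqrt c * (1 + \<bar>g x\<bar>)"
      using gF AE_space[of leb01]
    proof eventually_elim
      case (elim x)
      then have x: "0 < x" "x < 1" by (auto simp: space_restrict_space)
      have A: "(LINT t=ereal x..ereal z|lebesgue. a t) = tail a x - tail a z"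
        by (rule interval_integral_eq_tail[OF aint]) (use x assms(3,4) in auto)
      show ?case unfolding A
      proof (rule powr_le_slope[OF _ c])
        show "?F x = g x / sqrt (1 + (g x)\<^sup>2)" using elim by simp
        show "1 + ?F x \<le> c * (tail a x - tail a z)"
          using growth[of x] \<open>\<not> -1 < ?F z\<close> by linarith
      qed
    qed
    have int: "integrable leb01 (\<lambda>x. 2 * sqrt c * (1 + \<bar>g x\<bar>))"
      using gint finite_measure.integrable_const[OF finite_measure_leb01, of "1::real"] by simp
    have "(\<integral>\<^sup>+x. ennreal ((LINT t=ereal x..ereal z|lebesgue. a t) powr (- 1/2)) \<partial>lebesgue_on S) < \<infinity>"
      if "S \<in> sets borel" "S \<subseteq> {0<..<1}" for S
      by (rule nn_integral_lebesgue_on_subset_finite[OF that int bound]) (use c in simp)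
    note finite = this
    have "{0<..<z} \<subseteq> {0<..<1}" "{z<..<1} \<subseteq> {0<..<1}" using assms(3,4) by auto
    with finite[of "{0<..<z}"] finite[of "{z<..<1}"] assms(7) show False
      by (auto simp: less_top[symmetric])
  qed

  \<comment> \<open>so the flux is bounded away from \<open>\<plusminus>1\<close>, and the singular part, whose polar density is the
      flux, vanishes\<close>
  define \<theta> where "\<theta> = - ?F z"
  have \<theta>: "\<bar>?F y\<bar> \<le> \<theta>" "\<theta> < 1" for y
    using Fz[of y] F_nonpos[of y] Fz_gt by (auto simp: \<theta>_def)
  have \<theta>0: "0 \<le> \<theta>" using \<theta>(1)[of 0] by simp
  have \<sigma>0: "\<sigma> A = 0" if "A \<in> sets bor01" for A
  proof (rule finite_signed_measure_eq_0[OF \<sigma> \<theta>0 \<theta>(2) _ that])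
    fix B assume B: "B \<in> sets bor01"
    let ?T = "total_variation bor01 \<sigma>"
    interpret T: finite_measure ?T by (rule finite_measure_total_variation[OF \<sigma>])
    have "\<bar>LINT y|?T. indicator B y * ?F y\<bar> \<le> (LINT y|?T. \<bar>indicator B y * ?F y\<bar>)"
      by (rule integral_abs_bound)
    also have "\<dots> \<le> (LINT y|?T. \<theta> * indicator B y)"
    proof (rule integral_mono')
      show "integrable ?T (\<lambda>y. \<theta> * indicator B y)"
        using B by (intro integrable_mult_right integrable_real_indicator) (auto simp: T.emeasure_eq_measure)
    qed (use \<theta>(1) \<theta>0 in \<open>auto split: split_indicator\<close>)
    also have "\<dots> = \<theta> * measure ?T B" using B sets.sets_into_space[OF B] by (simp add: Int_absorb2)
    finally show "\<bar>\<sigma> B\<bar> \<le> \<theta> * measure ?T B"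
      using weak_equation_singular[OF eq k \<sigma> N B] by simp
  qed

  define v where "v = (\<lambda>x. ?F x / sqrt (1 - (?F x)\<^sup>2))"
  have slope: "\<exists>w. weak_deriv v w" "continuous_on UNIV v" "integrable leb01 v"
    "weak_deriv (\<lambda>x. v x / sqrt (1 + (v x)\<^sup>2)) (\<lambda>x. - k x)"
    unfolding v_def by (rule slope_of_flux[OF k \<theta>])+
  have gv: "AE x in leb01. g x = v x"
    unfolding v_def using gF by eventually_elim (rule curvature_slope(3), simp)
  have v_nonpos: "0 \<le> - v x" for x
  proof -
    have "0 \<le> 1 - (?F x)\<^sup>2" using \<theta>(1)[of x] \<theta>(2) by (simp add: abs_square_le_1)
    then show ?thesis using F_nonpos[of x] by (simp add: v_def divide_nonpos_nonneg)
  qed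
  have vint: "integrable leb01 (\<lambda>x. - v x)" using slope(3) by simp
  have Du_v: "Du A = - measure (lebesgue_density (\<lambda>x. - v x)) A" if A: "A \<in> sets bor01" for A
  proof -
    have "Du A = (LINT x|leb01. g x * indicator A x)"
      using Du_eq[OF A] \<sigma>0[OF A] by (simp add: set_lebesgue_integral_def mult.commute)
    also have "\<dots> = (LINT x|leb01. v x * indicator A x)"
    proof (rule integral_cong_AE)
      show "AE x in leb01. g x * indicator A x = v x * indicator A x"
        using gv by eventually_elim simp
    qed (use A in \<open>auto intro!: borel_measurable_integrable integrable_mult_indicator_leb01 gint slope(3) simp: sets_bor01_iff\<close>)
    also have "\<dots> = - measure (lebesgue_density (\<lambda>x. - v x)) A"
      by (simp add: measure_lebesgue_density[OF vint v_nonpos A])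
    finally show ?thesis .
  qed
  have "weak_deriv u v"
    unfolding weak_deriv_def
  proof (intro conjI allI impI uint slope(3))
    fix \<phi> assume \<phi>: "test_function \<phi>"
    have m: "\<phi> \<in> borel_measurable bor01"
      by (intro measurable_restrict_space1 borel_measurable_continuous_onI test_functionD(3)[OF \<phi>])
    have "(LINT x|leb01. u x * deriv \<phi> x) = - signed_integral bor01 Du \<phi>"
      using Du \<phi> by (simp add: BV_deriv_def)
    also have "signed_integral bor01 Du \<phi> = - (LINT x|lebesgue_density (\<lambda>x. - v x). \<phi> x)"
      by (rule signed_integral_uminus_measure[OF finite_measure_lebesgue_density[OF vint v_nonpos] sets_lebesgue_density Du_v])
    also have "\<dots> = (LINT x|leb01. v x * \<phi> x)"
      by (simp add: integral_lebesgue_density[OF vint v_nonpos m])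
    finally show "(LINT x|leb01. u x * deriv \<phi> x) = - (LINT x|leb01. v x * \<phi> x)" .
  qed
  moreover have "continuous_on {0..1} v" by (rule continuous_on_subset[OF slope(2)]) simp
  moreover have "v 0 = 0" "v 1 = 0" using F0[of 0] F1[of 1] by (simp_all add: v_def)
  moreover obtain w where "weak_deriv v w" using slope(1) by blast
  ultimately show ?thesis
    unfolding regular_solution_def using slope(4)
    by - (rule exI[of _ v], rule exI[of _ w], rule exI[of _ "\<lambda>x. - k x"], simp add: k_def)
qed

end
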